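(* Let $0<q<1$ and $0<a<q^{-2}$. For all integers $n,n'\ge 0$ the polynomials $D_n^{(a)}(\,\cdot\,|q)$ satisfy both of the following orthogonality relations, where $\mu(x):=q^{-x}+aq^{x+1}$: $$\sum_{k=0}^\infty \frac{(1-aq^{4k+1})(aq;q)_{2k}}{(1-aq)(q;q)_{2k}}\, q^{k(2k-1)}\, D_n^{(a)}(\mu (2k)|q)\, D_{n'}^{(a)}(\mu (2k)|q) =\frac{(aq^3;q^2)_\infty}{(q;q^2)_\infty}\, \frac{(q^2;q^2)_n\,q^{-n}}{(aq^2;q^2)_n}\,\delta_{nn'} ,$$ $$\sum_{k=0}^\infty \frac{(1-aq^{4k+3})(aq;q)_{2k+1}}{(1-aq)(q;q)_{2k+1}}\, q^{k(2k+1)}\, D_n^{(a)}(\mu (2k+1)|q)\, D_{n'}^{(a)}(\mu (2k+1)|q) =\frac{(aq^3;q^2)_\infty}{(q;q^2)_\infty}\, \frac{(q^2;q^2)_n\, q^{-n}}{(aq^2;q^2)_n}\,\delta_{nn'} .$$ Moreover, both corresponding orthogonality measures (the first supported on the points $q^{-2k}+aq^{2k+1}$, the second on the points $q^{-2k-1}+aq^{2k+2}$, $k=0,1,2,\dots$) are extremal.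
   Context: Notation: $(b;q)_m=\prod_{j=0}^{m-1}(1-bq^j)$, $(b;q)_\infty=\prod_{j\ge 0}(1-bq^j)$, $(b_1,\dots,b_r;q)_m=\prod_i (b_i;q)_m$. Quotients $(1-aq^{4k+1})(aq;q)_{2k}/(1-aq)$ and $(aq;q)_{2k+1}/(1-aq)$ are understood after cancelling the common factor $1-aq$ (relevant only when $aq=1$). The dual discrete $q$-ultraspherical polynomials $D_n^{(a)}(y|q)$ are defined by $$D_n^{(a)}(\mu(x)|q):={}_3\phi_2\left(q^{-x},\,aq^{x+1},\,q^{-n};\ \sqrt a\,q,\,-\sqrt a\,q;\ q,\,-q^{n+1}\right)=\sum_{m=0}^n\frac{(q^{-x},aq^{x+1},q^{-n};q)_m}{(\sqrt a\,q,-\sqrt a\,q,q;q)_m}(-q^{n+1})^m,\qquad \mu(x)=q^{-x}+aq^{x+1}.$$ Since $(q^{-x},aq^{x+1};q)_m=\prod_{j=0}^{m-1}\bigl(1+aq^{2j+1}-q^j\mu(x)\bigr)$, $D_n^{(a)}(y|q)$ is a polynomial of degree $n$ in $y=\mu(x)$. A positive orthogonality measure $\sigma$ on $\mathbb R$ for a family of polynomials is called extremal if the polynomials form a complete orthogonal set in the Hilbert space $L^2(\sigma)$ (i.e. their linear span is dense in $L^2(\sigma)$). *)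

theory Defs
  imports "HOL-Analysis.Analysis" "HOL-Computational_Algebra.Polynomial"
begin

section \<open>$q$-shifted factorials\<close>

definition qpoch :: "real \<Rightarrow> real \<Rightarrow> nat \<Rightarrow> real" where
  "qpoch b q m = (\<Prod>j<m. 1 - b * q ^ j)"

definition qpoch_inf :: "real \<Rightarrow> real \<Rightarrow> real" where
  "qpoch_inf b q = (\<Prod>j. 1 - b * q ^ j)"

definition qpochs :: "real list \<Rightarrow> real \<Rightarrow> nat \<Rightarrow> real" where
  "qpochs bs q m = (\<Prod>b\<leftarrow>bs. qpoch b q m)"

definition phi32 :: "real \<Rightarrow> real \<Rightarrow> real \<Rightarrow> real \<Rightarrow> real \<Rightarrow> real \<Rightarrow> real \<Rightarrow> real" where
  "phi32 a b c d e q z = (\<Sum>m. qpochs [a, b, c] q m / qpochs [d, e, q] q m * z ^ m)"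


section \<open>Dual discrete $q$-ultraspherical polynomials\<close>

definition mu :: "real \<Rightarrow> real \<Rightarrow> real \<Rightarrow> real" where
  "mu a q x = q powr (-x) + a * q powr (x + 1)"

text \<open>
  The polynomial in the variable $y$. The product over $j$ is
  $(q^{-x}, a q^{x+1}; q)_m$ rewritten in terms of $y = \mu(x)$; that the values at
  $y = \mu(x)$ are those of the defining ${}_3\phi_2$ series is the lemma
  \<open>poly_D_eq_phi32\<close> below.
\<close>

definition D :: "real \<Rightarrow> real \<Rightarrow> nat \<Rightarrow> real poly" where
  "D a q n = (\<Sum>m\<le>n.
     smult (qpoch (q powi (- int n)) q m / qpochs [sqrt a * q, - (sqrt a * q), q] q m
              * (- (q ^ (n + 1))) ^ m)
       (\<Prod>j<m. [: 1 + a * q ^ (2 * j + 1), - (q ^ j) :]))"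

lemma qpoch_mu:
  assumes "0 < q"
  shows "qpochs [q powr (-x), a * q powr (x + 1)] q m
           = (\<Prod>j<m. 1 + a * q ^ (2 * j + 1) - q ^ j * mu a q x)"
proof -
  have *: "q powr (-x) * q powr (x + 1) = q"
    using assms by (simp flip: powr_add)
  have "(1 - q powr (-x) * q ^ j) * (1 - a * q powr (x + 1) * q ^ j)
          = 1 + a * q ^ (2 * j + 1) - q ^ j * mu a q x" for j
  proof -
    have "(1 - q powr (-x) * q ^ j) * (1 - a * q powr (x + 1) * q ^ j)
            = 1 - q ^ j * mu a q x + a * (q powr (-x) * q powr (x + 1)) * (q ^ j * q ^ j)"
      by (simp add: mu_def algebra_simps)
    also have "\<dots> = 1 + a * q ^ (2 * j + 1) - q ^ j * mu a q x"
      unfolding * by (simp add: mult_2 power_add)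
    finally show ?thesis .
  qed
  then show ?thesis
    by (simp add: qpochs_def qpoch_def flip: prod.distrib)
qed

lemma poly_D_eq_sum:
  assumes "0 < q"
  shows "poly (D a q n) (mu a q x) =
    (\<Sum>m\<le>n. qpochs [q powr (-x), a * q powr (x + 1), q powi (- int n)] q m
            / qpochs [sqrt a * q, - (sqrt a * q), q] q m * (- (q ^ (n + 1))) ^ m)"
proof -
  have "qpochs [q powr (-x), a * q powr (x + 1), c] q m
          = (\<Prod>j<m. 1 + a * q ^ (2 * j + 1) - q ^ j * mu a q x) * qpoch c q m" for c m
    using qpoch_mu[OF assms, of x a m] by (simp add: qpochs_def)
  then show ?thesis
    by (simp add: D_def poly_sum poly_prod mult_ac)
qed

lemma poly_D_eq_phi32:
  assumes "0 < q"
  shows "poly (D a q n) (mu a q x) =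
    phi32 (q powr (-x)) (a * q powr (x + 1)) (q powi (- int n))
          (sqrt a * q) (- (sqrt a * q)) q (- (q ^ (n + 1)))"
proof -
  have "qpoch (q powi (- int n)) q m = 0" if "m > n" for m
    unfolding qpoch_def using that assms
    by (intro prod_zero) (auto intro!: bexI[of _ n] simp: power_int_minus)
  then have "qpochs [b, c, q powi (- int n)] q m = 0" if "m \<notin> {..n}" for b c m
    using that by (simp add: qpochs_def)
  then show ?thesis
    unfolding poly_D_eq_sum[OF assms] phi32_def
    by (intro suminf_finite[symmetric]) auto
qed


section \<open>Weights and orthogonality measures\<close>

text \<open>
  In both weights the factor $1 - aq$ of the quotient is cancelled, so that they also make
  sense for $aq = 1$. In \<open>w_even\<close> it cancels against $1 - aq^{4k+1}$ if $k = 0$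
  and against the first factor of $(aq;q)_{2k}$ otherwise.
\<close>

definition w_even :: "real \<Rightarrow> real \<Rightarrow> nat \<Rightarrow> real" where
  "w_even a q k =
     (if k = 0 then 1 else (1 - a * q ^ (4 * k + 1)) * qpoch (a * q\<^sup>2) q (2 * k - 1))
       / qpoch q q (2 * k) * q ^ (k * (2 * k - 1))"

definition w_odd :: "real \<Rightarrow> real \<Rightarrow> nat \<Rightarrow> real" where
  "w_odd a q k = (1 - a * q ^ (4 * k + 3)) * qpoch (a * q\<^sup>2) q (2 * k)
                   / qpoch q q (2 * k + 1) * q ^ (k * (2 * k + 1))"

lemma qpoch_Suc_shift: "qpoch b q (Suc m) = (1 - b) * qpoch (b * q) q m"
  by (simp add: qpoch_def prod.lessThan_Suc_shift mult_ac del: prod.lessThan_Suc)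

lemma w_even_eq:
  assumes "a * q \<noteq> 1"
  shows "w_even a q k = (1 - a * q ^ (4 * k + 1)) * qpoch (a * q) q (2 * k)
           / ((1 - a * q) * qpoch q q (2 * k)) * q ^ (k * (2 * k - 1))"
proof (cases k)
  case 0
  then show ?thesis using assms by (simp add: w_even_def qpoch_def)
next
  case (Suc l)
  have "qpoch (a * q) q (2 * k) = (1 - a * q) * qpoch (a * q\<^sup>2) q (2 * k - 1)"
    using qpoch_Suc_shift[of "a * q" q "2 * k - 1"] Suc
    by (simp add: power2_eq_square mult.assoc)
  then show ?thesis using assms Suc by (simp add: w_even_def)
qed

lemma w_odd_eq:
  assumes "a * q \<noteq> 1"
  shows "w_odd a q k = (1 - a * q ^ (4 * k + 3)) * qpoch (a * q) q (2 * k + 1)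
           / ((1 - a * q) * qpoch q q (2 * k + 1)) * q ^ (k * (2 * k + 1))"
proof -
  have "qpoch (a * q) q (2 * k + 1) = (1 - a * q) * qpoch (a * q\<^sup>2) q (2 * k)"
    using qpoch_Suc_shift[of "a * q" q "2 * k"] by (simp add: power2_eq_square mult.assoc)
  then show ?thesis using assms by (simp add: w_odd_def)
qed

text \<open>
  The Borel measure $\sum_k w_k \delta_{x_k}$ on the real line, as the image under $x$ of the
  measure on the naturals with masses $w_k$. Since \<^const>\<open>ennreal\<close> maps negative numbers
  to 0, this reading needs $w_k \ge 0$.
\<close>

definition discrete_measure :: "(nat \<Rightarrow> real) \<Rightarrow> (nat \<Rightarrow> real) \<Rightarrow> real measure" where
  "discrete_measure w x = distr (density (count_space UNIV) (\<lambda>k. ennreal (w k))) borel x"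

definition L2 :: "real measure \<Rightarrow> (real \<Rightarrow> real) set" where
  "L2 \<sigma> = {f \<in> borel_measurable \<sigma>. integrable \<sigma> (\<lambda>y. (f y)\<^sup>2)}"

definition L2_norm :: "real measure \<Rightarrow> (real \<Rightarrow> real) \<Rightarrow> real" where
  "L2_norm \<sigma> f = sqrt (\<integral>y. (f y)\<^sup>2 \<partial>\<sigma>)"

definition orthogonality_measure :: "(nat \<Rightarrow> real poly) \<Rightarrow> real measure \<Rightarrow> bool" where
  "orthogonality_measure P \<sigma> \<longleftrightarrow>
     sets \<sigma> = sets borel \<and>
     (\<forall>n. poly (P n) \<in> L2 \<sigma>) \<and>
     (\<forall>n. L2_norm \<sigma> (poly (P n)) > 0) \<and>
     (\<forall>n n'. n \<noteq> n' \<longrightarrow> (\<integral>y. poly (P n) y * poly (P n') y \<partial>\<sigma>) = 0)"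

definition extremal_measure :: "(nat \<Rightarrow> real poly) \<Rightarrow> real measure \<Rightarrow> bool" where
  "extremal_measure P \<sigma> \<longleftrightarrow>
     orthogonality_measure P \<sigma> \<and>
     (\<forall>f \<in> L2 \<sigma>. \<forall>\<epsilon>>0. \<exists>N c. L2_norm \<sigma> (\<lambda>y. f y - (\<Sum>n<N. c n * poly (P n) y)) < \<epsilon>)"

end

(*
  Write W(x) for the common form of both weights, x running over the numbers of one parity.
  Under x -> x - 1 the product (q^(-x), a q^(x+1); q)_m W(x) becomes, up to a constant, the same
  product of length m - 1 for the parameter a q^2 and the other parity.  All moments therefore
  reduce to the total masses, which are independent of the parity: a telescoping certificate gives
  S(a) = (1 - a q^3) S(a q^2), and S(0) is Euler's sum.  The moment functional L obtained in this
  way satisfies L(Phi_m psi_j) = L(Phi_m) q^(-m j) for a second polynomial basis psi_j, so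
  orthogonality of D_n to psi_j, j < n, is the vanishing of (q^(-j); q)_n given by the q-binomial
  theorem.

  Extremality: the Lagrange interpolation polynomials of a point mass at the first N + 1 nodes
  converge to it in the weighted l^2 space, with squared error O(q^N), since the Gaussian decay of
  the weights compensates the growth of the polynomials at the remaining nodes.
*)

theory Submission
  imports Defs
begin

section \<open>q-shifted factorials and Euler series\<close>

text \<open>Two different positive measures share all moments here, so the moment problem is
  indeterminate: density of the polynomials is not automatic and is proved directly for each parity.
  The equality of the two parities has one source. Euler's series has the factor 1 + z and vanishes
  at z = -1, so the even and odd halves of its value at z = 1 agree. The certificate, which moves in
  steps of two, and the shift, which swaps parities, only transport this equality. The basis
  \<open>psi\<close> is needed because pairing D_n with Phi_j directly would require a linearization
  of Phi_m Phi_j, whereas against \<open>psi\<close> the index m enters only through a geometric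
  factor. In the density estimate the exponents of q are quadratic in the node index l and the
  degree N: about 2 l^2 from the weight, 2 N^2 from the denominators and -4 l N from the growth of
  the interpolant. They combine to 2 (l - N)^2, which gives no decay in N near l = N. The linear
  terms decide there, so the bounds have to keep them.\<close>

lemma qpoch_0 [simp]: "qpoch b q 0 = 1"
  by (simp add: qpoch_def)

lemma qpoch_Suc: "qpoch b q (Suc m) = qpoch b q m * (1 - b * q ^ m)"
  by (simp add: qpoch_def)

lemma qpoch_pos:
  assumes "0 \<le> q" "q < 1" "b < 1"
  shows "0 < qpoch b q n"
proof -
  have "b * q ^ j < 1" for j
  proof (cases "b \<le> 0")
    case True
    then have "b * q ^ j \<le> 0" using assms by (intro mult_nonpos_nonneg) auto
    then show ?thesis by simp
  next
    case False
    then have "b * q ^ j \<le> b * 1" using assms by (intro mult_left_mono power_le_one) auto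
    then show ?thesis using assms by simp
  qed
  then show ?thesis
    unfolding qpoch_def by (intro prod_pos) simp
qed

lemma qpoch_le_1:
  assumes "0 \<le> q" "q < 1" "0 \<le> b" "b < 1"
  shows "qpoch b q n \<le> 1"
proof -
  have "b * q ^ j \<le> 1" for j
    using mult_mono[of b 1 "q ^ j" 1] assms by (simp add: power_le_one)
  with assms show ?thesis
    unfolding qpoch_def by (intro prod_le_1) auto
qed

lemma convergent_prod_qpoch:
  assumes "0 < q" "q < 1"
  shows "convergent_prod (\<lambda>j. 1 - b * q ^ j :: real)"
proof -
  have "summable (\<lambda>j. norm ((1 - b * q ^ j) - 1))"
    using assms by (simp add: abs_mult power_abs)
  then show ?thesis
    by (intro abs_convergent_prod_imp_convergent_prod summable_imp_abs_convergent_prod)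
qed

lemma qpoch_tendsto:
  assumes "0 < q" "q < 1"
  shows "qpoch b q \<longlonglongrightarrow> qpoch_inf b q"
proof -
  have "(\<lambda>n. qpoch b q (Suc n)) \<longlonglongrightarrow> qpoch_inf b q"
    using convergent_prod_LIMSEQ[OF convergent_prod_qpoch[OF assms, of b]]
    by (simp add: qpoch_def qpoch_inf_def lessThan_Suc_atMost)
  then show ?thesis by (rule LIMSEQ_imp_Suc)
qed

lemma qpoch_inf_shift:
  assumes "0 < q" "q < 1"
  shows "qpoch_inf b q = (1 - b) * qpoch_inf (b * q) q"
proof -
  have "(\<lambda>n. qpoch b q (Suc n)) \<longlonglongrightarrow> (1 - b) * qpoch_inf (b * q) q"
    unfolding qpoch_Suc_shift by (intro tendsto_intros qpoch_tendsto assms)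
  moreover have "(\<lambda>n. qpoch b q (Suc n)) \<longlonglongrightarrow> qpoch_inf b q"
    using qpoch_tendsto[OF assms] by (rule LIMSEQ_Suc)
  ultimately show ?thesis using LIMSEQ_unique by blast
qed

lemma qpoch_inf_pos:
  assumes "0 < q" "q < 1" "b < 1"
  shows "0 < qpoch_inf b q"
proof -
  have "1 - b * q ^ j \<noteq> 0" for j
  proof -
    have "qpoch b q (Suc j) \<noteq> 0" using qpoch_pos[of q b "Suc j"] assms by simp
    then show ?thesis by (simp add: qpoch_Suc)
  qed
  then have "qpoch_inf b q \<noteq> 0"
    unfolding qpoch_inf_def using prodinf_nonzero[OF convergent_prod_qpoch[OF assms(1,2)]] by blast
  moreover have "0 \<le> qpoch_inf b q"
    using qpoch_tendsto[OF assms(1,2)] qpoch_pos[of q b] assms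
    by (intro LIMSEQ_le_const[of "qpoch b q"]) (auto intro: less_imp_le)
  ultimately show ?thesis by simp
qed

text \<open>The partial products decrease to their limit. This bounds the denominators (q;q)_n from
  below uniformly in n.\<close>

lemma qpoch_inf_le_qpoch:
  assumes "0 < q" "q < 1" "0 \<le> b" "b < 1"
  shows "qpoch_inf b q \<le> qpoch b q n"
proof -
  have "decseq (qpoch b q)"
  proof (rule decseq_SucI)
    fix n
    have "qpoch b q n * (1 - b * q ^ n) \<le> qpoch b q n * 1"
      using qpoch_pos[of q b n] assms by (intro mult_left_mono) auto
    then show "qpoch b q (Suc n) \<le> qpoch b q n" by (simp add: qpoch_Suc)
  qed
  then show ?thesis using decseq_ge qpoch_tendsto[OF assms(1,2)] by blast
qed

lemma qpoch_double: "qpoch b q (2 * n) = qpoch b (q\<^sup>2) n * qpoch (b * q) (q\<^sup>2) n"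
  by (induction n) (simp_all add: qpoch_Suc algebra_simps flip: power_mult power_Suc)

lemma qpoch_square: "qpoch (b\<^sup>2) (q\<^sup>2) n = qpoch b q n * qpoch (- b) q n"
  by (induction n) (simp_all add: qpoch_Suc algebra_simps power2_eq_square power_mult_distrib)

text \<open>Splitting (q;q)_(2n) by parity of the exponents and factoring (q^2;q^2)_n gives
  (q;q^2)_n (-q;q)_n = (q;q)_(2n) / (q;q)_n. Numerator and denominator on the right have the same
  nonzero limit.\<close>

lemma qpoch_inf_euler:
  assumes "0 < q" "q < 1"
  shows "qpoch_inf (- q) q = 1 / qpoch_inf q (q\<^sup>2)"
proof -
  have q2: "0 < q\<^sup>2" "q\<^sup>2 < 1" using assms by (auto simp: power_less_one_iff)
  have pos: "qpoch q q n \<noteq> 0" for n using qpoch_pos[of q q n] assms by simp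
  have inf_pos: "qpoch_inf q q \<noteq> 0" using qpoch_inf_pos[of q q] assms by simp
  have *: "qpoch q (q\<^sup>2) n * qpoch (- q) q n = qpoch q q (2 * n) / qpoch q q n" for n
    using qpoch_double[of q q n] qpoch_square[of q q n] pos[of n]
    by (simp add: field_simps power2_eq_square)
  have "(\<lambda>n. qpoch q q (2 * n)) \<longlonglongrightarrow> qpoch_inf q q"
    using LIMSEQ_subseq_LIMSEQ[OF qpoch_tendsto[OF assms, of q], of "\<lambda>n. 2 * n"]
    by (simp add: strict_mono_def o_def)
  then have "(\<lambda>n. qpoch q q (2 * n) / qpoch q q n) \<longlonglongrightarrow> qpoch_inf q q / qpoch_inf q q"
    by (intro tendsto_divide qpoch_tendsto assms inf_pos)
  moreover have "(\<lambda>n. qpoch q (q\<^sup>2) n * qpoch (- q) q n)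
      \<longlonglongrightarrow> qpoch_inf q (q\<^sup>2) * qpoch_inf (- q) q"
    by (intro tendsto_mult qpoch_tendsto assms q2)
  ultimately have "qpoch_inf q (q\<^sup>2) * qpoch_inf (- q) q = 1"
    unfolding * using LIMSEQ_unique inf_pos by fastforce
  then show ?thesis by (metis mult_zero_left nonzero_mult_div_cancel_left zero_neq_one)
qed

section \<open>Euler's expansion of (-z;q)_inf and the common form of the weights\<close>

definition euler_coeff :: "real \<Rightarrow> nat \<Rightarrow> real" where
  "euler_coeff q x = q ^ (x choose 2) / qpoch q q x"

lemma euler_coeff_0 [simp]: "euler_coeff q 0 = 1"
  by (simp add: euler_coeff_def numeral_2_eq_2)

definition euler_series :: "real \<Rightarrow> real \<Rightarrow> real" where
  "euler_series q z = (\<Sum>x. euler_coeff q x * z ^ x)"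

text \<open>The exponents k (2k - 1) and k (2k + 1) are both x choose 2, for x = 2k and x = 2k + 1.
  The case x = 0 is the cancelled factor 1 - aq.\<close>

definition weight :: "real \<Rightarrow> real \<Rightarrow> nat \<Rightarrow> real" where
  "weight a q x = (if x = 0 then 1 else (1 - a * q ^ (2 * x + 1)) * qpoch (a * q\<^sup>2) q (x - 1))
     * euler_coeff q x"

lemma weight_0 [simp]: "weight a q 0 = 1"
  by (simp add: weight_def)

lemma weight_Suc:
  "weight a q (Suc x) = (1 - a * q ^ (2 * x + 3)) * qpoch (a * q\<^sup>2) q x * euler_coeff q (Suc x)"
  by (simp add: weight_def eval_nat_numeral)

lemma choose_two_mult_2: "2 * (x choose 2) = x * (x - 1)"
  by (cases x) (simp_all add: choose_two)

lemma w_even_eq_weight: "w_even a q k = weight a q (2 * k)"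
proof -
  have "2 * k choose 2 = k * (2 * k - 1)" using choose_two_mult_2[of "2 * k"] by simp
  then show ?thesis by (simp add: w_even_def weight_def euler_coeff_def mult.assoc)
qed

lemma w_odd_eq_weight: "w_odd a q k = weight a q (2 * k + 1)"
proof -
  have *: "(2 * k + 1) choose 2 = k * (2 * k + 1)" using choose_two_mult_2[of "2 * k + 1"] by simp
  have **: "2 * (2 * k + 1) + 1 = 4 * k + 3" by simp
  show ?thesis
    unfolding w_odd_def weight_def euler_coeff_def * ** by (simp add: mult.assoc)
qed

lemma mu_of_nat:
  assumes "0 < q"
  shows "mu a q (real x) = 1 / q ^ x + a * q ^ (x + 1)"
  using assms powr_realpow[OF assms, of "x + 1"]
  by (simp add: mu_def powr_minus powr_realpow divide_inverse add.commute)

context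
  fixes q :: real
  assumes q: "0 < q" "q < 1"
begin

lemma euler_coeff_pos: "0 < euler_coeff q x"
  using q qpoch_pos[of q q x] by (simp add: euler_coeff_def)

text \<open>Stated without division, in the shape in which the functional equation, the certificate
  and the index shift consume it.\<close>

lemma euler_coeff_Suc: "(1 - q ^ Suc x) * euler_coeff q (Suc x) = q ^ x * euler_coeff q x"
proof -
  have "q * q ^ x < 1" using q power_Suc_less_one[of q x] by simp
  then show ?thesis
    using q qpoch_pos[of q q x]
    by (simp add: euler_coeff_def qpoch_Suc field_simps numeral_2_eq_2 power_add)
qed

lemma euler_coeff_le: "euler_coeff q x \<le> q ^ (x choose 2) / qpoch_inf q q"
  unfolding euler_coeff_def using q qpoch_inf_pos[of q q] qpoch_inf_le_qpoch[of q q x]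
  by (intro divide_left_mono) (auto intro: mult_pos_pos qpoch_pos)

lemma summable_euler_coeff: "summable (euler_coeff q)"
proof (rule summable_comparison_test)
  have "euler_coeff q x \<le> q ^ x * (1 / (q * qpoch_inf q q))" for x
  proof -
    \<comment> \<open>A linear lower bound for the quadratic exponent suffices for comparison with a
      geometric series; its offset 1 costs the factor 1/q.\<close>
    have "x \<le> (x choose 2) + 1"
      by (induction x) (auto simp: numeral_2_eq_2)
    then have "q ^ ((x choose 2) + 1) \<le> q ^ x" using q by (intro power_decreasing) auto
    then have "q ^ (x choose 2) / qpoch_inf q q \<le> (q ^ x / q) / qpoch_inf q q"
      using q qpoch_inf_pos[of q q] by (intro divide_right_mono) (auto simp: field_simps)
    then show ?thesis using euler_coeff_le[of x] by simp
  qed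
  then show "\<exists>N. \<forall>n\<ge>N. norm (euler_coeff q n) \<le> q ^ n * (1 / (q * qpoch_inf q q))"
    using euler_coeff_pos by (auto simp: less_imp_le)
  show "summable (\<lambda>n. q ^ n * (1 / (q * qpoch_inf q q)))"
    using q by (intro summable_mult2 summable_geometric) simp
qed

lemma summable_euler_series:
  assumes "\<bar>z\<bar> \<le> 1"
  shows "summable (\<lambda>x. euler_coeff q x * z ^ x)"
proof (rule summable_comparison_test[OF _ summable_euler_coeff])
  have "norm (euler_coeff q n * z ^ n) \<le> euler_coeff q n * 1" for n
    unfolding norm_mult using euler_coeff_pos[of n] assms
    by (intro mult_mono) (auto simp: power_abs power_le_one)
  then show "\<exists>N. \<forall>n\<ge>N. norm (euler_coeff q n * z ^ n) \<le> euler_coeff q n"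
    by simp
qed

text \<open>In F(z) - F(zq) the constant term cancels, and \<open>euler_coeff_Suc\<close> turns the
  remaining terms into z F(zq). The closed unit interval is allowed because z = 1 and z = -1 are
  both used later.\<close>

lemma euler_series_step:
  assumes "\<bar>z\<bar> \<le> 1"
  shows "euler_series q z = (1 + z) * euler_series q (z * q)"
proof -
  have zq: "\<bar>z * q\<bar> \<le> 1" using assms q by (simp add: abs_mult mult_le_one)
  have "(\<lambda>x. euler_coeff q x * z ^ x - euler_coeff q x * (z * q) ^ x)
          sums (euler_series q z - euler_series q (z * q))"
    unfolding euler_series_def
    by (intro sums_diff summable_sums summable_euler_series assms zq)
  then have "(\<lambda>x. euler_coeff q (Suc x) * z ^ Suc x - euler_coeff q (Suc x) * (z * q) ^ Suc x)
          sums (euler_series q z - euler_series q (z * q))"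
    by (subst sums_Suc_iff) simp
  moreover have "euler_coeff q (Suc x) * z ^ Suc x - euler_coeff q (Suc x) * (z * q) ^ Suc x
      = z * (euler_coeff q x * (z * q) ^ x)" for x
  proof -
    have "euler_coeff q (Suc x) * z ^ Suc x - euler_coeff q (Suc x) * (z * q) ^ Suc x
      = z ^ Suc x * ((1 - q ^ Suc x) * euler_coeff q (Suc x))"
      by (simp add: algebra_simps power_mult_distrib)
    also have "\<dots> = z * (euler_coeff q x * (z * q) ^ x)"
      by (simp only: euler_coeff_Suc) (simp add: algebra_simps power_mult_distrib)
    finally show ?thesis .
  qed
  moreover have "(\<lambda>x. z * (euler_coeff q x * (z * q) ^ x)) sums (z * euler_series q (z * q))"
    unfolding euler_series_def by (intro sums_mult summable_sums summable_euler_series q zq)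
  ultimately have "euler_series q z - euler_series q (z * q) = z * euler_series q (z * q)"
    by (simp add: sums_unique2)
  then show ?thesis by (simp add: algebra_simps)
qed

text \<open>Iterating the functional equation drives the argument to 0, where continuity of the
  power series gives the value 1.\<close>

lemma euler_series_q: "euler_series q q = qpoch_inf (- q) q"
proof -
  have *: "euler_series q q = qpoch (- q) q n * euler_series q (q ^ Suc n)" for n
  proof (induction n)
    case (Suc n)
    have "q * q ^ n \<le> 1" using q by (simp add: mult_le_one power_le_one)
    then have "euler_series q (q ^ Suc n) = (1 + q ^ Suc n) * euler_series q (q ^ Suc (Suc n))"
      using euler_series_step[of "q ^ Suc n"] q by (simp add: abs_mult power_abs mult_ac)
    then show ?case unfolding Suc.IH by (simp add: qpoch_Suc mult_ac)
  qed simp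
  have "isCont (\<lambda>z. \<Sum>x. euler_coeff q x * z ^ x) 0"
    by (rule isCont_powser[of _ 1]) (use summable_euler_coeff in simp_all)
  moreover have "(\<lambda>n. q ^ Suc n) \<longlonglongrightarrow> 0" using q by (intro LIMSEQ_Suc LIMSEQ_realpow_zero) auto
  ultimately have "(\<lambda>n. euler_series q (q ^ Suc n)) \<longlonglongrightarrow> euler_series q 0"
    unfolding euler_series_def by (rule isCont_tendsto_compose)
  then have "(\<lambda>n. qpoch (- q) q n * euler_series q (q ^ Suc n)) \<longlonglongrightarrow> qpoch_inf (- q) q * euler_series q 0"
    by (intro tendsto_mult qpoch_tendsto q)
  moreover have "euler_series q 0 = 1" by (simp add: euler_series_def)
  ultimately show ?thesis unfolding *[symmetric] by (simp add: LIMSEQ_const_iff)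
qed

end

section \<open>Total masses and moments\<close>

text \<open>A telescoping certificate in the sense of creative telescoping, for the parameter shift
  a -> a q^2. It moves in steps of two so that one parity class is summed at a time.\<close>

definition weight_cert :: "real \<Rightarrow> real \<Rightarrow> nat \<Rightarrow> real" where
  "weight_cert q a x = a * q ^ (2 * x + 3) * qpoch (a * q ^ 3) q x * euler_coeff q x"

definition total_mass :: "real \<Rightarrow> real \<Rightarrow> real" where
  "total_mass q a = qpoch_inf (a * q ^ 3) (q\<^sup>2) / qpoch_inf q (q\<^sup>2)"

text \<open>At y = \<open>mu a q x\<close> this is (q^(-x), a q^(x+1); q)_m, by
  \<open>qpoch_mu\<close>.\<close>

definition Phi :: "real \<Rightarrow> real \<Rightarrow> nat \<Rightarrow> real poly" where
  "Phi q a m = (\<Prod>j<m. [: 1 + a * q ^ (2 * j + 1), - (q ^ j) :])"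

lemma Phi_0 [simp]: "Phi q a 0 = 1"
  by (simp add: Phi_def)

lemma Phi_Suc: "Phi q a (Suc m) = Phi q a m * [: 1 + a * q ^ (2 * m + 1), - (q ^ m) :]"
  by (simp add: Phi_def)

lemma poly_Phi: "poly (Phi q a m) y = (\<Prod>j<m. 1 + a * q ^ (2 * j + 1) - q ^ j * y)"
  by (simp add: Phi_def poly_prod mult.commute)

context
  fixes q :: real
  assumes q: "0 < q" "q < 1"
begin

text \<open>The functional equation gives F(-1) = 0, so both parity classes contribute half of F(1)
  = 2 F(q) = 2 / (q;q^2)_inf.\<close>

lemma euler_coeff_parity_sums:
  assumes "e < 2"
  shows "(\<lambda>k. euler_coeff q (2 * k + e)) sums (1 / qpoch_inf q (q\<^sup>2))"
proof -
  define f where "f x = euler_coeff q x * ((1 + (- 1) ^ (x + e)) / 2)" for x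
  have "euler_series q 1 = 2 * euler_series q q"
    using euler_series_step[OF q, of 1] by simp
  then have 1: "euler_coeff q sums (2 / qpoch_inf q (q\<^sup>2))"
    using summable_sums[OF summable_euler_coeff[OF q]]
    by (simp add: euler_series_def euler_series_q[OF q, unfolded euler_series_def]
          qpoch_inf_euler[OF q])
  have 2: "(\<lambda>x. euler_coeff q x * (- 1) ^ x) sums 0"
    using summable_sums[OF summable_euler_series[OF q, of "- 1"]] euler_series_step[OF q, of "- 1"]
    by (simp add: euler_series_def)
  have "(\<lambda>x. 1 / 2 * euler_coeff q x + ((- 1) ^ e / 2) * (euler_coeff q x * (- 1) ^ x))
      sums (1 / 2 * (2 / qpoch_inf q (q\<^sup>2)) + ((- 1) ^ e / 2) * 0)"
    by (intro sums_add sums_mult 1 2)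
  moreover have "f = (\<lambda>x. 1 / 2 * euler_coeff q x + ((- 1) ^ e / 2) * (euler_coeff q x * (- 1) ^ x))"
    by (rule ext) (simp add: f_def power_add field_simps)
  ultimately have "f sums (1 / qpoch_inf q (q\<^sup>2))" by simp
  moreover have "f x = 0" if "x \<notin> range (\<lambda>k. 2 * k + e)" for x
  proof -
    have "odd (x + e)"
    proof
      assume "even (x + e)"
      then obtain k where k: "x + e = 2 * k" by blast
      \<comment> \<open>For e = 1 the equation x + 1 = 2k forces k > 0, so the truncated difference
        is exact.\<close>
      with assms have "x = 2 * (k - e) + e" by linarith
      with that show False by blast
    qed
    then show ?thesis by (simp add: f_def)
  qed
  ultimately have "(\<lambda>k. f (2 * k + e)) sums (1 / qpoch_inf q (q\<^sup>2))"
    by (subst sums_mono_reindex) (auto simp: strict_mono_def)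
  moreover have "f (2 * k + e) = euler_coeff q (2 * k + e)" for k
    by (simp add: f_def power_add flip: mult_2)
  ultimately show ?thesis by simp
qed

text \<open>The upper bound does not involve \<open>a\<close>: it is the dominating series for the
  limit a -> 0, and later it supplies the Gaussian decay.\<close>

lemma weight_bounds:
  assumes "0 \<le> a" "a * q\<^sup>2 < 1"
  shows "0 < weight a q x" and "weight a q x \<le> euler_coeff q x"
proof -
  have "0 < weight a q x \<and> weight a q x \<le> euler_coeff q x"
  proof (cases x)
    case (Suc y)
    have "a * q ^ (2 * y + 3) = a * q\<^sup>2 * q ^ (2 * y + 1)"
      by (simp add: eval_nat_numeral)
    also have "\<dots> \<le> a * q\<^sup>2 * 1"
      using assms q by (intro mult_left_mono power_le_one) auto
    finally have *: "a * q ^ (2 * y + 3) < 1" "0 \<le> a * q ^ (2 * y + 3)"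
      using assms q by auto
    have **: "0 < qpoch (a * q\<^sup>2) q y" "qpoch (a * q\<^sup>2) q y \<le> 1"
      using qpoch_pos[of q "a * q\<^sup>2" y] qpoch_le_1[of q "a * q\<^sup>2" y] assms q by auto
    have "(1 - a * q ^ (2 * y + 3)) * qpoch (a * q\<^sup>2) q y \<le> 1"
      using * ** by (intro mult_le_one) auto
    moreover have "0 < (1 - a * q ^ (2 * y + 3)) * qpoch (a * q\<^sup>2) q y"
      using * ** by simp
    ultimately show ?thesis
      using euler_coeff_pos[OF q, of x] mult_right_mono[of _ 1 "euler_coeff q x"]
      unfolding Suc weight_Suc by simp
  qed (simp add: euler_coeff_0)
  then show "0 < weight a q x" and "weight a q x \<le> euler_coeff q x" by auto
qed

lemma summable_weight:
  assumes "0 \<le> a" "a * q\<^sup>2 < 1" "e < 2"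
  shows "summable (\<lambda>k. weight a q (2 * k + e))"
proof (rule summable_comparison_test)
  show "summable (\<lambda>k. euler_coeff q (2 * k + e))"
    using euler_coeff_parity_sums[OF assms(3)] by (simp add: sums_iff)
  show "\<exists>N. \<forall>k\<ge>N. norm (weight a q (2 * k + e)) \<le> euler_coeff q (2 * k + e)"
    using weight_bounds[OF assms(1,2)] by (simp add: less_imp_le)
qed

text \<open>With X = q^x every term is a multiple of P U, once \<open>euler_coeff_Suc\<close> is
  applied twice to express the coefficient at x through the one at x + 2. What remains is (1 - a q^5
  X^2)(1 - a q^2) = (1 - a q^3 X)(1 - a q^4 X) - a q^2 (1 - q X)(1 - q^2 X).\<close>

lemma weight_cert_step:
  "weight a q (x + 2) - (1 - a * q ^ 3) * weight (a * q\<^sup>2) q (x + 2)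
     = weight_cert q a (x + 2) - weight_cert q a x"
proof -
  define X P U where "X = q ^ x" and "P = qpoch (a * q ^ 3) q x" and "U = euler_coeff q (x + 2)"
  have X: "X \<noteq> 0" using q by (simp add: X_def)
  have "(1 - q * X) * ((1 - q * (q * X)) * U) = q * X * (X * euler_coeff q x)"
    using euler_coeff_Suc[OF q, of "x"] euler_coeff_Suc[OF q, of "Suc x"]
    by (simp add: X_def U_def mult_ac)
  then have u: "X\<^sup>2 * euler_coeff q x = (1 - q * X) * (1 - q\<^sup>2 * X) * U / q"
    using q by (simp add: field_simps power2_eq_square)
  have 1: "weight a q (x + 2) = (1 - a * q ^ 5 * X\<^sup>2) * ((1 - a * q\<^sup>2) * P) * U"
  proof -
    have "qpoch (a * q\<^sup>2) q (Suc x) = (1 - a * q\<^sup>2) * P"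
      by (simp add: qpoch_Suc_shift P_def eval_nat_numeral mult_ac)
    then show ?thesis
      using weight_Suc[of a q "Suc x"]
      by (simp add: U_def X_def eval_nat_numeral power_add mult_ac)
  qed
  have P2: "qpoch (a * q ^ 3) q (x + 2) = P * (1 - a * q ^ 3 * X) * (1 - a * q ^ 4 * X)"
    by (simp add: qpoch_Suc P_def X_def eval_nat_numeral mult_ac)
  have 2: "(1 - a * q ^ 3) * weight (a * q\<^sup>2) q (x + 2)
      = (1 - a * q ^ 7 * X\<^sup>2) * (P * (1 - a * q ^ 3 * X) * (1 - a * q ^ 4 * X)) * U"
  proof -
    have "weight (a * q\<^sup>2) q (x + 2)
        = (1 - a * q ^ 7 * X\<^sup>2) * qpoch (a * q ^ 4) q (Suc x) * U"
      using weight_Suc[of "a * q\<^sup>2" q "Suc x"]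
      by (simp add: U_def X_def eval_nat_numeral power_add mult_ac)
    moreover have "(1 - a * q ^ 3) * qpoch (a * q ^ 4) q (Suc x) = qpoch (a * q ^ 3) q (x + 2)"
      using qpoch_Suc_shift[of "a * q ^ 3" q "Suc x"] by (simp add: eval_nat_numeral mult_ac)
    ultimately show ?thesis unfolding P2[symmetric] by (simp add: mult_ac)
  qed
  have 3: "weight_cert q a (x + 2) = a * q ^ 7 * X\<^sup>2 * (P * (1 - a * q ^ 3 * X) * (1 - a * q ^ 4 * X)) * U"
    unfolding weight_cert_def P2 by (simp add: U_def X_def eval_nat_numeral power_add mult_ac)
  have "weight_cert q a x = a * q ^ 3 * P * (X\<^sup>2 * euler_coeff q x)"
    by (simp add: weight_cert_def P_def X_def eval_nat_numeral power_add mult_ac)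
  then have 4: "weight_cert q a x = a * q ^ 2 * P * ((1 - q * X) * (1 - q\<^sup>2 * X) * U)"
    unfolding u using q by (simp add: eval_nat_numeral)
  show ?thesis
    unfolding 1 2 3 4 by algebra
qed

text \<open>The start of the telescoping: no boundary term is left at the lower end, as if the
  certificate vanished at e - 2.\<close>

lemma weight_cert_init:
  assumes "e < 2"
  shows "weight a q e - (1 - a * q ^ 3) * weight (a * q\<^sup>2) q e = weight_cert q a e"
proof (cases "e = 0")
  case True
  then show ?thesis by (simp add: weight_cert_def euler_coeff_0)
next
  case False
  with assms have e: "e = Suc 0" by simp
  show ?thesis
    unfolding e weight_Suc weight_cert_def by (simp add: qpoch_Suc eval_nat_numeral algebra_simps)
qed

lemma weight_cert_tendsto_0:
  assumes "0 \<le> a" "a * q ^ 3 < 1"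
  shows "weight_cert q a \<longlonglongrightarrow> 0"
proof (rule tendsto_rabs_zero_cancel, rule tendsto_sandwich[of "\<lambda>_. 0"])
  have "\<bar>weight_cert q a x\<bar> \<le> a * euler_coeff q x" for x
  proof -
    have "0 < qpoch (a * q ^ 3) q x" "qpoch (a * q ^ 3) q x \<le> 1"
      using qpoch_pos[of q "a * q ^ 3" x] qpoch_le_1[of q "a * q ^ 3" x] assms q by auto
    moreover from this have "a * q ^ (2 * x + 3) * qpoch (a * q ^ 3) q x \<le> a * 1 * 1"
      using assms(1) q by (intro mult_mono mult_left_mono power_le_one mult_nonneg_nonneg) auto
    ultimately show ?thesis
      using mult_right_mono[of "a * q ^ (2 * x + 3) * qpoch (a * q ^ 3) q x" a "euler_coeff q x"]
        euler_coeff_pos[OF q, of x] assms q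
      by (simp add: weight_cert_def abs_mult)
  qed
  then show "\<forall>\<^sub>F x in sequentially. \<bar>weight_cert q a x\<bar> \<le> a * euler_coeff q x" by simp
  have "(\<lambda>x. a * euler_coeff q x) \<longlonglongrightarrow> a * 0"
    by (intro tendsto_mult_left summable_LIMSEQ_zero summable_euler_coeff q)
  then show "(\<lambda>x. a * euler_coeff q x) \<longlonglongrightarrow> 0" by simp
qed simp_all

lemma suminf_weight_shift:
  assumes "0 \<le> a" "a * q\<^sup>2 < 1" "e < 2"
  shows "(\<Sum>k. weight a q (2 * k + e)) = (1 - a * q ^ 3) * (\<Sum>k. weight (a * q\<^sup>2) q (2 * k + e))"
proof -
  have "q\<^sup>2 < 1" using q by (simp add: power_less_one_iff)
  then have aq: "a * q\<^sup>2 * q\<^sup>2 < 1" "a * q ^ 3 < 1"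
    using assms q mult_strict_mono'[of "a * q\<^sup>2" 1 "q\<^sup>2" 1] mult_strict_mono'[of "a * q\<^sup>2" 1 q 1]
    by (simp_all add: power2_eq_square power3_eq_cube mult.assoc)
  let ?d = "\<lambda>k. weight a q (2 * k + e) - (1 - a * q ^ 3) * weight (a * q\<^sup>2) q (2 * k + e)"
  have "(\<Sum>k\<le>n. ?d k) = weight_cert q a (2 * n + e)" for n
  proof (induction n)
    case 0
    then show ?case using weight_cert_init[OF assms(3)] by simp
  next
    case (Suc n)
    then show ?case using weight_cert_step[of a "2 * n + e"] by simp
  qed
  moreover have "(\<lambda>n. weight_cert q a (2 * n + e)) \<longlonglongrightarrow> 0"
    using LIMSEQ_subseq_LIMSEQ[OF weight_cert_tendsto_0[OF assms(1) aq(2)], of "\<lambda>n. 2 * n + e"]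
    by (simp add: strict_mono_def o_def)
  ultimately have "?d sums 0" by (simp add: sums_def_le)
  moreover have "?d sums ((\<Sum>k. weight a q (2 * k + e))
      - (1 - a * q ^ 3) * (\<Sum>k. weight (a * q\<^sup>2) q (2 * k + e)))"
    using assms aq q by (intro sums_diff sums_mult summable_sums summable_weight) auto
  ultimately show ?thesis using sums_unique2 by fastforce
qed

lemma total_mass_shift: "total_mass q a = (1 - a * q ^ 3) * total_mass q (a * q\<^sup>2)"
  using qpoch_inf_shift[of "q\<^sup>2" "a * q ^ 3"] q
  by (simp add: total_mass_def power_less_one_iff mult_ac)

text \<open>Iterating a -> a q^2 gives S(a) = (a q^3; q^2)_n S(a q^(2n)). Tannery's theorem moves
  the limit inside the sum, and S(0) is the parity half of Euler's series.\<close>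

lemma weight_sums:
  assumes "0 \<le> a" "a * q\<^sup>2 < 1" "e < 2"
  shows "(\<lambda>k. weight a q (2 * k + e)) sums total_mass q a"
proof -
  define S where "S b = (\<Sum>k. weight b q (2 * k + e))" for b
  have q2: "0 < q\<^sup>2" "q\<^sup>2 < 1" using q by (auto simp: power_less_one_iff)
  have aq: "a * (q\<^sup>2) ^ n * q\<^sup>2 < 1" for n
  proof -
    have "a * q\<^sup>2 * (q\<^sup>2) ^ n \<le> a * q\<^sup>2 * 1"
      using assms(1) q by (intro mult_left_mono power_le_one mult_nonneg_nonneg) auto
    then show ?thesis using assms by (simp add: mult_ac)
  qed
  have S: "S a = qpoch (a * q ^ 3) (q\<^sup>2) n * S (a * (q\<^sup>2) ^ n)" for n
  proof (induction n)
    case (Suc n)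
    have "S (a * (q\<^sup>2) ^ n) = (1 - a * (q\<^sup>2) ^ n * q ^ 3) * S (a * (q\<^sup>2) ^ n * q\<^sup>2)"
      unfolding S_def using assms q aq[of n] by (intro suminf_weight_shift) auto
    then show ?case unfolding Suc.IH by (simp add: qpoch_Suc mult_ac)
  qed simp
  have lim: "(\<lambda>n. (q\<^sup>2) ^ n) \<longlonglongrightarrow> 0" using q2 by (intro LIMSEQ_realpow_zero) auto
  have cont: "(\<lambda>n. weight (a * (q\<^sup>2) ^ n) q x) \<longlonglongrightarrow> weight 0 q x" for x
  proof -
    have "isCont (\<lambda>b. weight b q x) 0"
      unfolding weight_def qpoch_def by (cases "x = 0") (auto intro!: continuous_intros)
    moreover have "(\<lambda>n. a * (q\<^sup>2) ^ n) \<longlonglongrightarrow> 0" using tendsto_mult_left[OF lim, of a] by simp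
    ultimately show ?thesis by (rule isCont_tendsto_compose)
  qed
  have "(\<lambda>n. S (a * (q\<^sup>2) ^ n)) \<longlonglongrightarrow> S 0"
    unfolding S_def
  proof (rule tannerys_theorem[THEN conjunct2, THEN conjunct2])
    show "summable (\<lambda>k. euler_coeff q (2 * k + e))"
      using euler_coeff_parity_sums[OF assms(3)] by (simp add: sums_iff)
    show "\<forall>\<^sub>F (k, n) in sequentially \<times>\<^sub>F sequentially.
       norm (weight (a * (q\<^sup>2) ^ n) q (2 * k + e)) \<le> euler_coeff q (2 * k + e)"
    proof (intro always_eventually allI)
      fix p :: "nat \<times> nat"
      show "case p of (k, n) \<Rightarrow> norm (weight (a * (q\<^sup>2) ^ n) q (2 * k + e)) \<le> euler_coeff q (2 * k + e)"
        using assms q aq weight_bounds[of "a * (q\<^sup>2) ^ snd p" "2 * fst p + e"]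
        by (simp add: case_prod_unfold)
    qed
  qed (use cont in auto)
  then have "(\<lambda>n. qpoch (a * q ^ 3) (q\<^sup>2) n * S (a * (q\<^sup>2) ^ n)) \<longlonglongrightarrow> qpoch_inf (a * q ^ 3) (q\<^sup>2) * S 0"
    by (intro tendsto_mult qpoch_tendsto q2)
  then have "S a = qpoch_inf (a * q ^ 3) (q\<^sup>2) * S 0"
    unfolding S[symmetric] by (simp add: LIMSEQ_const_iff)
  moreover have "weight 0 q x = euler_coeff q x" for x
    by (simp add: weight_def qpoch_def)
  then have "S 0 = 1 / qpoch_inf q (q\<^sup>2)"
    using euler_coeff_parity_sums[OF assms(3)] by (simp add: S_def sums_iff)
  ultimately show ?thesis
    using summable_sums[OF summable_weight[OF assms]] by (simp add: S_def total_mass_def)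
qed

section \<open>Moments by the index shift\<close>

text \<open>Since q mu_a(x + 1) = mu_(a q^2)(x), the factor with index j + 1 at x + 1 is the factor
  with index j at x for the parameter a q^2. Only the factor j = 0 is left over.\<close>

lemma poly_Phi_Suc_shift:
  "poly (Phi q a (Suc m)) (mu a q (real (Suc x)))
    = (1 + a * q - mu a q (real (Suc x))) * poly (Phi q (a * q\<^sup>2) m) (mu (a * q\<^sup>2) q (real x))"
proof -
  have *: "1 + a * q ^ (2 * Suc j + 1) - q ^ Suc j * mu a q (real (Suc x))
      = 1 + (a * q\<^sup>2) * q ^ (2 * j + 1) - q ^ j * mu (a * q\<^sup>2) q (real x)" for j
    unfolding mu_of_nat[OF q(1)] using q by (simp add: field_simps eval_nat_numeral)
  show ?thesis
    unfolding poly_Phi prod.lessThan_Suc_shift * by simp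
qed

text \<open>The left-over factor is (1 - q^(-x-1)) (1 - a q^(x+2)). Its first part cancels the last
  denominator of the Euler coefficient; its second part prolongs the q-shifted factorial by one
  factor.\<close>

lemma weight_Suc_shift:
  "weight a q (Suc x) * (1 + a * q - mu a q (real (Suc x)))
     = - (1 / q) * (1 - a * q\<^sup>2) * (1 - a * q ^ 3) * weight (a * q\<^sup>2) q x"
proof -
  have mu: "1 + a * q - mu a q (real (Suc x)) = - (1 - q ^ Suc x) * (1 - a * q ^ (x + 2)) / (q * q ^ x)"
    unfolding mu_of_nat[OF q(1)] using q by (simp add: field_simps eval_nat_numeral)
  have "weight a q (Suc x) * (1 + a * q - mu a q (real (Suc x)))
     = - (1 - a * q ^ (2 * x + 3)) * (qpoch (a * q\<^sup>2) q x * (1 - a * q\<^sup>2 * q ^ x))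
         * ((1 - q ^ Suc x) * euler_coeff q (Suc x)) / (q * q ^ x)"
  proof -
    have *: "a * q\<^sup>2 * q ^ x = a * q ^ (x + 2)" by (simp add: eval_nat_numeral mult_ac)
    have "A * P * U * (- B * C / r) = - A * (P * C) * (B * U) / r" for A P U B C r :: real
      by simp
    then show ?thesis
      unfolding weight_Suc mu * by blast
  qed
  also have "\<dots> = - (1 / q) * ((1 - a * q ^ (2 * x + 3)) * qpoch (a * q\<^sup>2) q (Suc x) * euler_coeff q x)"
  proof -
    have "- A * (P * C) * (Q * E) / (r * Q) = - (1 / r) * (A * (P * C) * E)"
      if "Q \<noteq> 0" for A P C Q E r :: real using that by simp
    moreover have "q ^ x \<noteq> 0" using q by simp
    ultimately show ?thesis unfolding euler_coeff_Suc[OF q] qpoch_Suc by blast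
  qed
  also have "(1 - a * q ^ (2 * x + 3)) * qpoch (a * q\<^sup>2) q (Suc x) * euler_coeff q x
     = (1 - a * q\<^sup>2) * (1 - a * q ^ 3) * weight (a * q\<^sup>2) q x"
  proof (cases x)
    case 0
    then show ?thesis by (simp add: qpoch_Suc euler_coeff_0)
  next
    case (Suc y)
    have "qpoch (a * q\<^sup>2) q (Suc (Suc y)) = (1 - a * q\<^sup>2) * ((1 - a * q ^ 3) * qpoch (a * q ^ 4) q y)"
      by (simp only: qpoch_Suc_shift) (simp add: eval_nat_numeral mult_ac)
    then show ?thesis
      unfolding Suc weight_Suc by (simp add: eval_nat_numeral mult_ac)
  qed
  finally show ?thesis by simp
qed

text \<open>The induction varies \<open>a\<close> and \<open>e\<close>, because the shift changes
  both. Odd sums reduce to even ones directly. In even sums the term x = 0 drops out, as mu(0) = 1 +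
  aq is a root of the first factor of Phi. Of the constants produced, 1 - a q^3 is absorbed by
  \<open>total_mass_shift\<close> and 1 - a q^2 by the q-shifted factorial.\<close>

lemma moment_sums:
  assumes "0 \<le> a" "a * q\<^sup>2 < 1" "e < 2"
  shows "(\<lambda>k. weight a q (2 * k + e) * poly (Phi q a m) (mu a q (real (2 * k + e))))
           sums (total_mass q a * (- (1 / q)) ^ m * qpoch (a * q\<^sup>2) (q\<^sup>2) m)"
  using assms
proof (induction m arbitrary: a e)
  case 0
  then show ?case using weight_sums by simp
next
  case (Suc m)
  have aq: "0 \<le> a * q\<^sup>2" "a * q\<^sup>2 * q\<^sup>2 < 1"
    using Suc.prems q mult_strict_mono'[of "a * q\<^sup>2" 1 "q\<^sup>2" 1]
    by (auto simp: power_less_one_iff)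
  define c where "c = - (1 / q) * (1 - a * q\<^sup>2) * (1 - a * q ^ 3)"
  define f where "f x = weight a q x * poly (Phi q a (Suc m)) (mu a q (real x))" for x
  define g where "g x = weight (a * q\<^sup>2) q x * poly (Phi q (a * q\<^sup>2) m) (mu (a * q\<^sup>2) q (real x))" for x
  define L where "L = total_mass q (a * q\<^sup>2) * (- (1 / q)) ^ m * qpoch (a * q\<^sup>2 * q\<^sup>2) (q\<^sup>2) m"
  have f_Suc: "f (Suc x) = c * g x" for x
    unfolding f_def g_def c_def poly_Phi_Suc_shift
    by (simp only: weight_Suc_shift mult.assoc[symmetric])
  have f_0: "f 0 = 0"
    using mu_of_nat[OF q(1), of a 0] q by (simp add: f_def poly_Phi prod.lessThan_Suc_shift del: prod.lessThan_Suc)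
  have g_sums: "(\<lambda>k. c * g (2 * k + e')) sums (c * L)" if "e' < 2" for e'
    unfolding g_def L_def using Suc.IH[OF aq that] by (rule sums_mult)
  have "(\<lambda>k. f (2 * k + e)) sums (c * L)"
  proof (cases "e = 0")
    case True
    have "(\<lambda>k. f (2 * Suc k)) sums (c * L)"
      using g_sums[of 1] by (simp flip: f_Suc)
    then show ?thesis
      by (subst (asm) sums_Suc_iff) (simp add: True f_0)
  next
    case False
    with Suc.prems have "e = 1" by simp
    then show ?thesis using g_sums[of 0] by (simp add: f_Suc)
  qed
  also have "c * L = total_mass q a * (- (1 / q)) ^ Suc m * qpoch (a * q\<^sup>2) (q\<^sup>2) (Suc m)"
    unfolding total_mass_shift[of a] qpoch_Suc_shift c_def L_def by (simp add: mult_ac)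
  finally show ?case by (simp add: f_def)
qed

end

section \<open>Orthogonality\<close>

text \<open>The top coefficient is exported because it alone determines the squared norm of
  D_n.\<close>

lemma poly_in_graded_basis:
  fixes P :: "nat \<Rightarrow> real poly"
  assumes "\<And>j. degree (P j) \<le> j" "\<And>j. coeff (P j) j \<noteq> 0" "degree p \<le> n"
  obtains c where "p = (\<Sum>j\<le>n. smult (c j) (P j))" "c n = coeff p n / coeff (P n) n"
proof -
  have "\<exists>c. p = (\<Sum>j\<le>n. smult (c j) (P j)) \<and> c n = coeff p n / coeff (P n) n"
    using assms(3)
  proof (induction n arbitrary: p)
    case 0
    have "p = smult (coeff p 0 / coeff (P 0) 0) (P 0)"
    proof (rule poly_eqI)
      fix i
      show "coeff p i = coeff (smult (coeff p 0 / coeff (P 0) 0) (P 0)) i"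
        using 0 assms(1)[of 0] assms(2)[of 0] by (cases i) (auto simp: coeff_eq_0)
    qed
    then show ?case by (intro exI[of _ "\<lambda>_. coeff p 0 / coeff (P 0) 0"]) auto
  next
    case (Suc n)
    define d where "d = coeff p (Suc n) / coeff (P (Suc n)) (Suc n)"
    have "degree (p - smult d (P (Suc n))) \<le> n"
    proof (rule degree_le, intro allI impI)
      fix i assume "n < i"
      then consider "i = Suc n" | "i > Suc n" by linarith
      then show "coeff (p - smult d (P (Suc n))) i = 0"
        using Suc.prems assms(1)[of "Suc n"] assms(2)[of "Suc n"]
        by cases (auto simp: d_def coeff_eq_0)
    qed
    from Suc.IH[OF this] obtain c where c: "p - smult d (P (Suc n)) = (\<Sum>j\<le>n. smult (c j) (P j))"
      by blast
    have "p = (\<Sum>j\<le>Suc n. smult ((c(Suc n := d)) j) (P j))"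
      using c by (simp add: algebra_simps)
    then show ?case unfolding d_def by (metis fun_upd_same)
  qed
  with that show ?thesis by blast
qed

text \<open>This is (-1)^m q^(m choose 2) times the Gaussian binomial coefficient. The product form
  avoids negative powers and vanishes by itself for m > n.\<close>

definition gauss_coeff :: "real \<Rightarrow> nat \<Rightarrow> nat \<Rightarrow> real" where
  "gauss_coeff q n m = (\<Prod>j<m. q ^ n - q ^ j) / qpoch q q m"

lemma degree_Phi: "degree (Phi q a m) \<le> m"
proof (induction m)
  case (Suc m)
  have "degree (Phi q a (Suc m)) \<le> degree (Phi q a m) + degree [: 1 + a * q ^ (2 * m + 1), - (q ^ m) :]"
    unfolding Phi_Suc by (rule degree_mult_le)
  also have "\<dots> \<le> m + 1" by (intro add_mono Suc.IH) simp
  finally show ?case by simp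
qed simp

lemma coeff_Phi: "coeff (Phi q a m) m = (\<Prod>j<m. - (q ^ j))"
proof (induction m)
  case (Suc m)
  have "coeff (Phi q a m) (Suc m) = 0"
    using degree_Phi[of q a m] by (intro coeff_eq_0) simp
  with Suc show ?case by (simp add: Phi_Suc mult_pCons_right)
qed simp

text \<open>
  The recurrence is chosen so that $\psi_j$ multiplies the moment of every $\Phi_m$ by $q^{-mj}$.
  For $j = 0$ the truncated index $j - 1$ is harmless: the coefficient of that term vanishes.
\<close>

fun psi :: "real \<Rightarrow> real \<Rightarrow> nat \<Rightarrow> real poly" where
  "psi q a 0 = 1"
| "psi q a (Suc j) = smult (1 / (1 + 1 / q ^ Suc j))
     (pCons 0 (psi q a j) + smult (a * q * (1 / q ^ j - 1)) (psi q a (j - 1)))"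

lemma degree_psi: "degree (psi q a j) \<le> j"
proof (induction j rule: less_induct)
  case (less j)
  show ?case
  proof (cases j)
    case (Suc i)
    have "degree (pCons 0 (psi q a i)) \<le> Suc i"
      using less.IH[of i] Suc degree_pCons_le[of 0 "psi q a i"] by simp
    moreover have "degree (smult (a * q * (1 / q ^ i - 1)) (psi q a (i - 1))) \<le> Suc i"
      using less.IH[of "i - 1"] Suc
      by (intro order.trans[OF degree_smult_le]) linarith
    ultimately show ?thesis
      unfolding Suc psi.simps by (rule order.trans[OF degree_smult_le degree_add_le])
  qed simp
qed

lemma coeff_psi: "coeff (psi q a j) j = (\<Prod>i<j. 1 / (1 + 1 / q ^ Suc i))"
proof (induction j)
  case (Suc j)
  have "coeff (psi q a (j - 1)) (Suc j) = 0"
    using degree_psi[of q a "j - 1"] by (intro coeff_eq_0) simp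
  with Suc show ?case by simp
qed simp

context
  fixes q :: real
  assumes q: "0 < q" "q < 1"
begin

lemma gauss_coeff_eq: "gauss_coeff q n m = qpoch (1 / q ^ n) q m * (q ^ n) ^ m / qpoch q q m"
proof -
  have "qpoch (1 / q ^ n) q m * (q ^ n) ^ m = (\<Prod>j<m. q ^ n - q ^ j)"
    using q by (induction m) (simp_all add: qpoch_Suc field_simps)
  then show ?thesis by (simp add: gauss_coeff_def)
qed

text \<open>A comparison of the coefficients of v^(m+1) in (v;q)_(n+1) = (v;q)_n (1 - v
  q^n).\<close>

lemma gauss_coeff_pascal:
  "gauss_coeff q (Suc n) (Suc m) = gauss_coeff q n (Suc m) - q ^ n * gauss_coeff q n m"
proof -
  define N where "N = (\<Prod>j<m. q ^ n - q ^ j)"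
  have "(\<Prod>j<Suc m. q ^ Suc n - q ^ j) = (q ^ Suc n - 1) * (\<Prod>j<m. q * (q ^ n - q ^ j))"
    by (simp add: prod.lessThan_Suc_shift algebra_simps del: prod.lessThan_Suc)
  then have 1: "(\<Prod>j<Suc m. q ^ Suc n - q ^ j) = (q ^ Suc n - 1) * q ^ m * N"
    by (simp add: prod.distrib N_def del: prod.lessThan_Suc)
  have Q: "qpoch q q m \<noteq> 0" "1 - q * q ^ m \<noteq> 0"
    using qpoch_pos[of q q m] q power_Suc_less_one[of q m] by auto
  have "gauss_coeff q (Suc n) (Suc m) = (q ^ Suc n - 1) * q ^ m * N / (qpoch q q m * (1 - q * q ^ m))"
    unfolding gauss_coeff_def 1 by (simp add: qpoch_Suc)
  also have "\<dots> = N * (q ^ n - q ^ m) / (qpoch q q m * (1 - q * q ^ m)) - q ^ n * (N / qpoch q q m)"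
    using Q by (simp add: field_simps)
  also have "\<dots> = gauss_coeff q n (Suc m) - q ^ n * gauss_coeff q n m"
    by (simp add: gauss_coeff_def N_def qpoch_Suc)
  finally show ?thesis .
qed

lemma gauss_binomial: "(\<Sum>m\<le>n. gauss_coeff q n m * v ^ m) = qpoch v q n"
proof (induction n)
  case 0
  then show ?case by (simp add: gauss_coeff_def)
next
  case (Suc n)
  have top: "gauss_coeff q n (Suc n) = 0" by (simp add: gauss_coeff_def)
  have "(\<Sum>m\<le>Suc n. gauss_coeff q (Suc n) m * v ^ m)
      = gauss_coeff q (Suc n) 0 + (\<Sum>m\<le>n. gauss_coeff q (Suc n) (Suc m) * v ^ Suc m)"
    by (subst sum.atMost_Suc_shift) simp
  also have "\<dots> = gauss_coeff q n 0 + (\<Sum>m\<le>n. gauss_coeff q n (Suc m) * v ^ Suc m)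
      - q ^ n * v * (\<Sum>m\<le>n. gauss_coeff q n m * v ^ m)"
    unfolding gauss_coeff_pascal
    by (simp add: gauss_coeff_def[of _ _ 0] algebra_simps sum_subtractf sum_distrib_left)
  also have "gauss_coeff q n 0 + (\<Sum>m\<le>n. gauss_coeff q n (Suc m) * v ^ Suc m)
      = (\<Sum>m\<le>Suc n. gauss_coeff q n m * v ^ m)"
    by (subst sum.atMost_Suc_shift) simp
  also have "\<dots> = (\<Sum>m\<le>n. gauss_coeff q n m * v ^ m)" by (simp add: top)
  finally show ?case unfolding Suc.IH qpoch_Suc by (simp add: algebra_simps)
qed

end

section \<open>Pairing with \<open>psi\<close>, orthogonality and squared norms, for either parity
  \<open>e\<close>\<close>

locale dual_ultraspherical =
  fixes q a :: real and e :: nat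
  assumes q: "0 < q" "q < 1" and a: "0 \<le> a" "a * q\<^sup>2 < 1" and e: "e < 2"
begin

abbreviation w :: "nat \<Rightarrow> real" where "w k \<equiv> weight a q (2 * k + e)"
abbreviation y :: "nat \<Rightarrow> real" where "y k \<equiv> mu a q (real (2 * k + e))"

definition moment :: "nat \<Rightarrow> real" where
  "moment m = total_mass q a * (- (1 / q)) ^ m * qpoch (a * q\<^sup>2) (q\<^sup>2) m"

lemma moment_Suc: "moment (Suc m) = - (1 / q) * (1 - a * q ^ (2 * m + 2)) * moment m"
proof -
  have *: "a * q ^ (2 * m + 2) = a * q\<^sup>2 * (q\<^sup>2) ^ m"
    by (simp add: power_add power_mult power2_eq_square)
  show ?thesis unfolding moment_def qpoch_Suc * by simp
qed

lemma w_Phi_sums: "(\<lambda>k. w k * poly (Phi q a m) (y k)) sums moment m"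
  unfolding moment_def by (rule moment_sums[OF q a e])

text \<open>Multiplication by y acts as y Phi_m = q^(-m) ((1 + a q^(2m+1)) Phi_m - Phi_(m+1)). With
  \<open>moment_Suc\<close>, the pairing of Phi_m with y psi_i is L(Phi_m) q^(-mi) times q^(-m) (1 +
  q^(-i-1)) + a q^(m+1) (1 - q^(-i)). The powers q^(-m) and q^m are what psi_(i+1) and psi_(i-1)
  contribute, and this dictates the recurrence of \<open>psi\<close>.\<close>

lemma w_Phi_psi_sums:
  "(\<lambda>k. w k * (poly (Phi q a m) (y k) * poly (psi q a j) (y k))) sums (moment m * (1 / q ^ j) ^ m)"
proof (induction j arbitrary: m rule: less_induct)
  case (less j)
  show ?case
  proof (cases j)
    case 0
    then show ?thesis using w_Phi_sums by (simp add: psi.simps)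
  next
    case (Suc i)
    define Z where "Z = (1 / q ^ i) ^ m"
    define d where "d = 1 + 1 / q ^ Suc i"
    have d: "d > 0" unfolding d_def using q by (intro add_pos_pos) auto
    have 1: "(\<lambda>k. w k * (poly (Phi q a n) (y k) * poly (psi q a i) (y k)))
        sums (moment n * (1 / q ^ i) ^ n)" for n
      using less.IH[of i n] Suc by simp
    have 2: "(\<lambda>k. (a * q * (1 / q ^ i - 1)) * (w k * (poly (Phi q a m) (y k) * poly (psi q a (i - 1)) (y k))))
        sums (a * q * (1 / q ^ i - 1) * (moment m * (q ^ m * Z)))"
    proof (cases i)
      case (Suc l)
      have "(1 / q ^ (i - 1)) ^ m = q ^ m * Z"
        using q by (simp add: Z_def Suc field_simps power_mult_distrib)
      then show ?thesis
        using less.IH[of "i - 1" m] \<open>j = Suc i\<close> by (intro sums_mult) simp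
    qed simp
    have "(\<lambda>k. 1 / d * (1 / q ^ m * ((1 + a * q ^ (2 * m + 1)) * (w k * (poly (Phi q a m) (y k) * poly (psi q a i) (y k)))
           - w k * (poly (Phi q a (Suc m)) (y k) * poly (psi q a i) (y k)))
         + (a * q * (1 / q ^ i - 1)) * (w k * (poly (Phi q a m) (y k) * poly (psi q a (i - 1)) (y k)))))
       sums (1 / d * (1 / q ^ m * ((1 + a * q ^ (2 * m + 1)) * (moment m * Z) - moment (Suc m) * (1 / q ^ i) ^ Suc m)
         + a * q * (1 / q ^ i - 1) * (moment m * (q ^ m * Z))))"
      unfolding Z_def by (intro sums_mult sums_add sums_diff 1 2[unfolded Z_def])
    moreover have "1 / d * (1 / q ^ m * ((1 + a * q ^ (2 * m + 1)) * (w k * (poly (Phi q a m) (y k) * poly (psi q a i) (y k)))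
           - w k * (poly (Phi q a (Suc m)) (y k) * poly (psi q a i) (y k)))
         + (a * q * (1 / q ^ i - 1)) * (w k * (poly (Phi q a m) (y k) * poly (psi q a (i - 1)) (y k))))
       = w k * (poly (Phi q a m) (y k) * poly (psi q a j) (y k))" for k
    proof -
      have *: "1 / d * (1 / Q * (C * (W * (p * s)) - W * ((p * (C - Q * Y)) * s)) + A * (W * (p * r)))
          = W * (p * (1 / d * (Y * s + A * r)))" if "Q \<noteq> 0" for C Q W p s Y A r :: real
        using that by (simp add: field_simps)
      have P: "poly (Phi q a (Suc m)) (y k) = poly (Phi q a m) (y k) * (1 + a * q ^ (2 * m + 1) - q ^ m * y k)"
        by (simp add: Phi_Suc algebra_simps)
      show ?thesis
        unfolding P using q *[of "q ^ m"] by (simp add: Suc d_def)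
    qed
    moreover have "1 / d * (1 / q ^ m * ((1 + a * q ^ (2 * m + 1)) * (moment m * Z) - moment (Suc m) * (1 / q ^ i) ^ Suc m)
         + a * q * (1 / q ^ i - 1) * (moment m * (q ^ m * Z))) = moment m * (1 / q ^ j) ^ m"
    proof -
      have Zi: "(1 / q ^ i) ^ Suc m = Z / q ^ i" by (simp add: Z_def)
      have Zj: "(1 / q ^ j) ^ m = Z / q ^ m"
        by (simp add: Z_def Suc power_mult_distrib power_divide mult.commute)
      define Q I B where "Q = q ^ m" and "I = q ^ i" and "B = a * q ^ (2 * m + 1)"
      have pos: "Q > 0" "I > 0" using q by (simp_all add: Q_def I_def)
      have B: "B / Q = a * q * Q" and B': "a * q ^ (2 * m + 2) = B * q"
        using q by (simp_all add: B_def Q_def power_add power_mult power2_eq_square power_mult_distrib)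
      have "1 / Q * ((1 + B) * (moment m * Z) - - (1 / q) * (1 - B * q) * moment m * (Z / I))
          + B / Q * ((1 / I - 1) * (moment m * Z)) = d * (moment m * (Z / Q))"
        using q pos by (simp add: d_def I_def[symmetric] field_simps)
      then show ?thesis
        unfolding Zi Zj moment_Suc B' unfolding B using d
        by (simp add: Q_def I_def B_def mult_ac)
    qed
    ultimately show ?thesis by simp
  qed
qed

text \<open>The parameters with sqrt a and -sqrt a merge into base q^2, and q^(nm) goes into
  \<open>gauss_coeff\<close>. The remaining (-q)^m / (a q^2; q^2)_m is the reciprocal of the
  m-dependent part of \<open>moment m\<close>.\<close>

lemma D_eq_sum_Phi:
  "D a q n = (\<Sum>m\<le>n. smult (gauss_coeff q n m * (- q) ^ m / qpoch (a * q\<^sup>2) (q\<^sup>2) m) (Phi q a m))"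
proof -
  have "qpoch (q powi (- int n)) q m / qpochs [sqrt a * q, - (sqrt a * q), q] q m * (- (q ^ (n + 1))) ^ m
      = gauss_coeff q n m * (- q) ^ m / qpoch (a * q\<^sup>2) (q\<^sup>2) m" for m
  proof -
    have "qpoch (a * q\<^sup>2) (q\<^sup>2) m = qpoch (sqrt a * q) q m * qpoch (- (sqrt a * q)) q m"
      using qpoch_square[of "sqrt a * q" q m] a by (simp add: power_mult_distrib)
    moreover have "(- (q ^ (n + 1))) ^ m = (q ^ n) ^ m * (- q) ^ m"
      by (simp add: mult.commute flip: power_mult_distrib)
    ultimately show ?thesis
      using q by (simp add: qpochs_def gauss_coeff_eq power_int_minus inverse_eq_divide mult_ac)
  qed
  then show ?thesis by (simp add: D_def Phi_def)
qed

lemma qpoch_aq2_pos: "0 < qpoch (a * q\<^sup>2) (q\<^sup>2) m"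
  using a q by (intro qpoch_pos) (auto simp: power_less_one_iff)

text \<open>The moments cancel against the coefficients of D_n, which leaves the q-binomial sum at v
  = q^(-j).\<close>

lemma w_D_psi_sums:
  "(\<lambda>k. w k * (poly (D a q n) (y k) * poly (psi q a j) (y k)))
     sums (total_mass q a * qpoch (1 / q ^ j) q n)"
proof -
  define d where "d m = gauss_coeff q n m * (- q) ^ m / qpoch (a * q\<^sup>2) (q\<^sup>2) m" for m
  have "(\<lambda>k. \<Sum>m\<le>n. d m * (w k * (poly (Phi q a m) (y k) * poly (psi q a j) (y k))))
      sums (\<Sum>m\<le>n. d m * (moment m * (1 / q ^ j) ^ m))"
    by (intro sums_sum sums_mult w_Phi_psi_sums)
  moreover have "(\<Sum>m\<le>n. d m * (w k * (poly (Phi q a m) (y k) * poly (psi q a j) (y k))))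
      = w k * (poly (D a q n) (y k) * poly (psi q a j) (y k))" for k
    unfolding D_eq_sum_Phi d_def[symmetric]
    by (simp add: poly_sum sum_distrib_left sum_distrib_right mult_ac)
  moreover have "d m * (moment m * (1 / q ^ j) ^ m) = total_mass q a * (gauss_coeff q n m * (1 / q ^ j) ^ m)" for m
  proof -
    have "(- q) ^ m * (- (1 / q)) ^ m = 1" using q by (simp flip: power_mult_distrib)
    moreover have "d m * (moment m * (1 / q ^ j) ^ m)
        = total_mass q a * (gauss_coeff q n m * (1 / q ^ j) ^ m) * ((- q) ^ m * (- (1 / q)) ^ m)"
      using qpoch_aq2_pos[of m] by (simp add: d_def moment_def)
    ultimately show ?thesis by simp
  qed
  ultimately show ?thesis
    by (simp add: gauss_binomial[OF q] flip: sum_distrib_left)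
qed

lemma qpoch_inverse_power_eq_0:
  assumes "j < n"
  shows "qpoch (1 / q ^ j) q n = 0"
  unfolding qpoch_def using assms q by (intro prod_zero) auto

lemma degree_D: "degree (D a q n) \<le> n"
  unfolding D_eq_sum_Phi
  by (intro degree_sum_le) (auto intro!: order.trans[OF degree_smult_le] order.trans[OF degree_Phi])

lemma coeff_D:
  "coeff (D a q n) n = gauss_coeff q n n * (- q) ^ n / qpoch (a * q\<^sup>2) (q\<^sup>2) n * (\<Prod>j<n. - (q ^ j))"
proof -
  have "coeff (D a q n) n = (\<Sum>m\<le>n. gauss_coeff q n m * (- q) ^ m / qpoch (a * q\<^sup>2) (q\<^sup>2) m * coeff (Phi q a m) n)"
    by (simp add: D_eq_sum_Phi coeff_sum)
  also have "\<dots> = (\<Sum>m\<in>{n}. gauss_coeff q n m * (- q) ^ m / qpoch (a * q\<^sup>2) (q\<^sup>2) m * coeff (Phi q a m) n)"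
  proof (intro sum.mono_neutral_right ballI)
    fix m assume "m \<in> {..n} - {n}"
    then have "degree (Phi q a m) < n" using degree_Phi[of q a m] by simp
    then show "gauss_coeff q n m * (- q) ^ m / qpoch (a * q\<^sup>2) (q\<^sup>2) m * coeff (Phi q a m) n = 0"
      by (simp add: coeff_eq_0)
  qed auto
  finally show ?thesis by (simp add: coeff_Phi)
qed

lemma coeff_D_nonzero: "coeff (D a q n) n \<noteq> 0"
proof -
  have "q ^ n \<noteq> q ^ j" if "j < n" for j
    using power_strict_decreasing[OF that q] by simp
  then have "gauss_coeff q n n \<noteq> 0"
    using qpoch_pos[of q q n] q by (simp add: gauss_coeff_def)
  then show ?thesis unfolding coeff_D using q qpoch_aq2_pos[of n] by simp
qed

lemma coeff_psi_pos: "0 < coeff (psi q a j) j"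
  unfolding coeff_psi using q by (intro prod_pos) (auto intro!: divide_pos_pos add_pos_pos)

text \<open>The quotient of leading coefficients is the coefficient of psi_n in D_n, and psi_j with
  j < n pairs to zero with D_n. So this is the squared norm of D_n divided by the total
  mass.\<close>

lemma squared_norm_D:
  "coeff (D a q n) n / coeff (psi q a n) n * qpoch (1 / q ^ n) q n
     = qpoch (q\<^sup>2) (q\<^sup>2) n * q powi (- int n) / qpoch (a * q\<^sup>2) (q\<^sup>2) n"
proof -
  \<comment> \<open>K is q^(n(n+1)/2). In the end only its square matters, so the halved exponent is
    never written.\<close>
  define K where "K = (\<Prod>i<n. q ^ Suc i)"
  have K: "K > 0" unfolding K_def using q by (intro prod_pos) auto
  have K2: "K\<^sup>2 = (q ^ n) ^ n * q ^ n"
    unfolding K_def by (induction n) (simp_all add: power_mult_distrib power2_eq_square flip: power_mult)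
  have s1: "(- 1) ^ n * (- 1 :: real) ^ n = 1" by (simp flip: power_mult_distrib)
  have "qpoch (1 / q ^ n) q n = (\<Prod>i<n. 1 - 1 / q ^ Suc i)"
  proof -
    have "(\<Prod>i<n. 1 - 1 / q ^ n * q ^ i) = (\<Prod>i<n. 1 - 1 / q ^ n * q ^ (n - Suc i))"
      by (rule prod.nat_diff_reindex[symmetric])
    also have "\<dots> = (\<Prod>i<n. 1 - 1 / q ^ Suc i)"
    proof (rule prod.cong)
      fix i assume "i \<in> {..<n}"
      then have "q ^ n = q ^ (n - Suc i) * q ^ Suc i" by (simp only: power_add[symmetric]) simp
      then show "1 - 1 / q ^ n * q ^ (n - Suc i) = 1 - 1 / q ^ Suc i" using q by simp
    qed simp
    finally show ?thesis by (simp add: qpoch_def)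
  qed
  also have "\<dots> = (\<Prod>i<n. (- 1) * (1 - q * q ^ i) / q ^ Suc i)"
    using q by (intro prod.cong) (auto simp: field_simps)
  also have "\<dots> = (- 1) ^ n * qpoch q q n / K"
    by (simp only: prod.distrib prod_dividef qpoch_def K_def prod_constant card_lessThan)
  finally have 1: "qpoch (1 / q ^ n) q n = (- 1) ^ n * qpoch q q n / K" .
  have "coeff (psi q a n) n = (\<Prod>i<n. q ^ Suc i / (1 - (- q) * q ^ i))"
    unfolding coeff_psi using q by (intro prod.cong) (auto simp: field_simps)
  then have 2: "coeff (psi q a n) n = K / qpoch (- q) q n"
    by (simp add: prod_dividef qpoch_def K_def)
  have "(\<Prod>j<n. - (q ^ j)) = (\<Prod>j<n. (- 1) * q ^ Suc j / q)"
    using q by (intro prod.cong) auto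
  also have "\<dots> = (- 1) ^ n * K / q ^ n"
    by (simp only: prod.distrib prod_dividef K_def) simp
  finally have 3: "(\<Prod>j<n. - (q ^ j)) = (- 1) ^ n * K / q ^ n" .
  have 4: "gauss_coeff q n n = (- 1) ^ n * (q ^ n) ^ n / K"
    unfolding gauss_coeff_eq[OF q] 1 using qpoch_pos[of q q n] q by simp
  have 5: "qpoch (- q) q n > 0"
    using q by (intro qpoch_pos) auto
  have 6: "qpoch (q\<^sup>2) (q\<^sup>2) n = qpoch q q n * qpoch (- q) q n" by (rule qpoch_square)
  have 7: "(- q) ^ n = (- 1) ^ n * q ^ n" by (rule power_minus)
  define A B E S where "A = qpoch (a * q\<^sup>2) (q\<^sup>2) n" and "B = qpoch q q n" and "E = qpoch (- q) q n"
    and "S = (- 1 :: real) ^ n"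
  define Q where "Q = q ^ n"
  have Q: "Q > 0" using q by (simp add: Q_def)
  have "A > 0" using qpoch_aq2_pos by (simp add: A_def)
  have SS: "S * S = 1" using s1 by (simp add: S_def)
  have "coeff (D a q n) n / coeff (psi q a n) n * qpoch (1 / q ^ n) q n
      = (S * Q ^ n / K * (S * Q) / A * (S * K / Q)) / (K / E) * (S * B / K)"
    unfolding coeff_D 1 2 3 4 7 by (simp add: A_def B_def E_def S_def Q_def)
  also have "\<dots> = (S * S) * (S * S) * (Q ^ n * Q) * (B * E) / (A * Q * K\<^sup>2)"
    using K Q \<open>A > 0\<close> by (simp add: field_simps power2_eq_square)
  also have "\<dots> = B * E / (A * Q)"
    using K2 K unfolding SS by (simp add: Q_def)
  finally show ?thesis
    using q by (simp add: 6 A_def B_def E_def Q_def power_int_minus field_simps)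
qed

text \<open>The polynomial of smaller index n' is expanded in \<open>psi\<close>. For j <= n' <= n
  only j = n can survive, and that requires n' = n.\<close>

lemma D_orthogonality:
  "(\<lambda>k. w k * poly (D a q n) (y k) * poly (D a q n') (y k))
     sums (total_mass q a * (qpoch (q\<^sup>2) (q\<^sup>2) n * q powi (- int n) / qpoch (a * q\<^sup>2) (q\<^sup>2) n)
           * (if n = n' then 1 else 0))"
proof (induction n' n rule: linorder_wlog)
  case (le n' n)
  obtain c where c: "D a q n' = (\<Sum>j\<le>n'. smult (c j) (psi q a j))"
      "c n' = coeff (D a q n') n' / coeff (psi q a n') n'"
    using poly_in_graded_basis[of "psi q a" "D a q n'" n'] degree_psi[of q a] coeff_psi_pos degree_D[of n']
    by (metis less_irrefl)
  have "(\<lambda>k. \<Sum>j\<le>n'. c j * (w k * (poly (D a q n) (y k) * poly (psi q a j) (y k))))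
      sums (\<Sum>j\<le>n'. c j * (total_mass q a * qpoch (1 / q ^ j) q n))"
    by (intro sums_sum sums_mult w_D_psi_sums)
  moreover have "(\<Sum>j\<le>n'. c j * (w k * (poly (D a q n) (y k) * poly (psi q a j) (y k))))
      = w k * poly (D a q n) (y k) * poly (D a q n') (y k)" for k
    unfolding c(1) by (simp add: poly_sum sum_distrib_left mult_ac)
  moreover have "(\<Sum>j\<le>n'. c j * (total_mass q a * qpoch (1 / q ^ j) q n))
      = (\<Sum>j\<in>(if n = n' then {n} else {}). c j * (total_mass q a * qpoch (1 / q ^ j) q n))"
    using le by (intro sum.mono_neutral_right) (auto simp: qpoch_inverse_power_eq_0)
  moreover have "\<dots> = total_mass q a * (qpoch (q\<^sup>2) (q\<^sup>2) n * q powi (- int n) / qpoch (a * q\<^sup>2) (q\<^sup>2) n)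
           * (if n = n' then 1 else 0)"
  proof (cases "n = n'")
    case True
    then have "c n * qpoch (1 / q ^ n) q n
        = qpoch (q\<^sup>2) (q\<^sup>2) n * q powi (- int n) / qpoch (a * q\<^sup>2) (q\<^sup>2) n"
      using squared_norm_D[of n] c(2) by simp
    then have "c n * (total_mass q a * qpoch (1 / q ^ n) q n)
        = total_mass q a * (qpoch (q\<^sup>2) (q\<^sup>2) n * q powi (- int n) / qpoch (a * q\<^sup>2) (q\<^sup>2) n)"
      by (metis mult.left_commute)
    with True show ?thesis by simp
  qed simp
  ultimately show ?case by simp
next
  case (sym n n')
  then show ?case by (cases "n = n'") (simp_all add: mult_ac)
qed

end

section \<open>Polynomial density in weighted sequence spaces\<close>

lemma sets_discrete_measure [measurable_cong]: "sets (discrete_measure w x) = sets borel"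
  by (simp add: discrete_measure_def)

lemma
  assumes "\<And>k. 0 \<le> w k" "f \<in> borel_measurable borel"
  shows integrable_discrete_measure:
      "integrable (discrete_measure w x) f \<longleftrightarrow> summable (\<lambda>k. \<bar>w k * f (x k)\<bar>)"
    and integral_discrete_measure:
      "summable (\<lambda>k. \<bar>w k * f (x k)\<bar>) \<Longrightarrow> (\<integral>y. f y \<partial>discrete_measure w x) = (\<Sum>k. w k * f (x k))"
proof -
  show *: "integrable (discrete_measure w x) f \<longleftrightarrow> summable (\<lambda>k. \<bar>w k * f (x k)\<bar>)"
    unfolding discrete_measure_def using assms
    by (simp add: integrable_distr_eq integrable_density integrable_count_space_nat_iff)
  have "(\<integral>y. f y \<partial>discrete_measure w x) = (\<integral>k. w k * f (x k) \<partial>count_space UNIV)"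
    unfolding discrete_measure_def using assms
    by (simp add: integral_distr integral_density)
  then show "summable (\<lambda>k. \<bar>w k * f (x k)\<bar>) \<Longrightarrow>
      (\<integral>y. f y \<partial>discrete_measure w x) = (\<Sum>k. w k * f (x k))"
    by (simp add: integral_count_space_nat integrable_count_space_nat_iff)
qed

text \<open>Summability is part of the notion because the value of \<open>suminf\<close> at a
  divergent series says nothing. The bound is on the squared norm.\<close>

definition l2_small :: "(nat \<Rightarrow> real) \<Rightarrow> (nat \<Rightarrow> real) \<Rightarrow> real \<Rightarrow> bool" where
  "l2_small w v \<epsilon> \<longleftrightarrow> summable (\<lambda>k. w k * (v k)\<^sup>2) \<and> (\<Sum>k. w k * (v k)\<^sup>2) < \<epsilon>"

text \<open>The inequality (u + v)^2 <= 2 u^2 + 2 v^2 replaces Minkowski's; hence the factor 2 here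
  and the quarters of epsilon below.\<close>

lemma l2_small_add:
  assumes w: "\<And>k. 0 \<le> w k" and "l2_small w u \<epsilon>" "l2_small w v \<delta>"
  shows "l2_small w (\<lambda>k. u k + v k) (2 * (\<epsilon> + \<delta>))"
proof -
  let ?b = "\<lambda>k. 2 * (w k * (u k)\<^sup>2 + w k * (v k)\<^sup>2)"
  have b: "?b sums (2 * ((\<Sum>k. w k * (u k)\<^sup>2) + (\<Sum>k. w k * (v k)\<^sup>2)))"
    using assms by (intro sums_mult sums_add summable_sums) (auto simp: l2_small_def)
  have le: "w k * (u k + v k)\<^sup>2 \<le> ?b k" for k
  proof -
    have "(u k + v k)\<^sup>2 \<le> 2 * ((u k)\<^sup>2 + (v k)\<^sup>2)"
      using sum_squares_bound[of "u k" "v k"] by (simp add: power2_sum)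
    then have "w k * (u k + v k)\<^sup>2 \<le> w k * (2 * ((u k)\<^sup>2 + (v k)\<^sup>2))"
      using w by (intro mult_left_mono)
    then show ?thesis by (simp add: algebra_simps)
  qed
  have s: "summable (\<lambda>k. w k * (u k + v k)\<^sup>2)"
    using b le w by (intro summable_comparison_test[OF _ sums_summable[OF b]]) simp
  have "(\<Sum>k. w k * (u k + v k)\<^sup>2) \<le> (\<Sum>k. ?b k)"
    by (rule suminf_le[OF le s sums_summable[OF b]])
  with b s assms(2,3) show ?thesis by (simp add: l2_small_def sums_iff)
qed

definition poly_approximable :: "(nat \<Rightarrow> real) \<Rightarrow> (nat \<Rightarrow> real) \<Rightarrow> (nat \<Rightarrow> real) \<Rightarrow> bool" where
  "poly_approximable w x g \<longleftrightarrow> (\<forall>\<epsilon>>0. \<exists>p. l2_small w (\<lambda>k. g k - poly p (x k)) \<epsilon>)"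

lemma poly_approximable_add:
  assumes "\<And>k. 0 \<le> w k" "poly_approximable w x f" "poly_approximable w x g"
  shows "poly_approximable w x (\<lambda>k. f k + g k)"
  unfolding poly_approximable_def
proof (intro allI impI)
  fix \<epsilon> :: real assume "\<epsilon> > 0"
  then have "\<epsilon> / 4 > 0" by simp
  with assms obtain p p' where
    "l2_small w (\<lambda>k. f k - poly p (x k)) (\<epsilon> / 4)" "l2_small w (\<lambda>k. g k - poly p' (x k)) (\<epsilon> / 4)"
    unfolding poly_approximable_def by blast
  from l2_small_add[OF assms(1) this]
  show "\<exists>p. l2_small w (\<lambda>k. f k + g k - poly p (x k)) \<epsilon>"
    by (intro exI[of _ "p + p'"]) (simp add: algebra_simps)
qed

lemma poly_approximable_mult:
  assumes "poly_approximable w x f"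
  shows "poly_approximable w x (\<lambda>k. c * f k)"
  unfolding poly_approximable_def
proof (intro allI impI)
  fix \<epsilon> :: real assume \<epsilon>: "\<epsilon> > 0"
  \<comment> \<open>Dividing by c^2 + 1 instead of c^2 covers c = 0 as well.\<close>
  have c: "c\<^sup>2 + 1 > 0" by (simp add: add_nonneg_pos)
  then have "\<epsilon> / (c\<^sup>2 + 1) > 0" using \<epsilon> by simp
  with assms obtain p where p: "l2_small w (\<lambda>k. f k - poly p (x k)) (\<epsilon> / (c\<^sup>2 + 1))"
    unfolding poly_approximable_def by blast
  define s where "s = (\<Sum>k. w k * (f k - poly p (x k))\<^sup>2)"
  have "(\<lambda>k. c\<^sup>2 * (w k * (f k - poly p (x k))\<^sup>2)) sums (c\<^sup>2 * s)"
    unfolding s_def using p by (intro sums_mult summable_sums) (simp add: l2_small_def)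
  then have *: "(\<lambda>k. w k * (c * f k - poly (smult c p) (x k))\<^sup>2) sums (c\<^sup>2 * s)"
    by (simp add: power_mult_distrib mult_ac flip: right_diff_distrib)
  have "c\<^sup>2 * s \<le> c\<^sup>2 * (\<epsilon> / (c\<^sup>2 + 1))"
    using p by (intro mult_left_mono) (auto simp: l2_small_def s_def)
  also have "\<dots> < \<epsilon>" using c \<epsilon> by (simp add: field_simps)
  finally show "\<exists>p. l2_small w (\<lambda>k. c * f k - poly p (x k)) \<epsilon>"
    using * by (intro exI[of _ "smult c p"]) (simp only: l2_small_def sums_iff)
qed

lemma poly_approximable_finite_support:
  assumes "\<And>k. 0 \<le> w k" "\<And>k. poly_approximable w x (\<lambda>l. of_bool (l = k))"
  shows "poly_approximable w x (\<lambda>l. if l < K then f l else 0)"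
proof (induction K)
  case 0
  then show ?case
    by (auto simp: poly_approximable_def l2_small_def intro!: exI[of _ 0])
next
  case (Suc K)
  have "(\<lambda>l. if l < Suc K then f l else 0) = (\<lambda>l. (if l < K then f l else 0) + f K * of_bool (l = K))"
    by (auto simp: less_Suc_eq)
  then show ?case
    using poly_approximable_add[OF assms(1) Suc poly_approximable_mult[OF assms(2)]] by simp
qed

text \<open>The tail of \<open>f\<close> beyond K is small in norm, and the head is a finite
  combination of point masses, so density reduces to the latter.\<close>

lemma poly_approximable_l2:
  assumes "\<And>k. 0 \<le> w k" "\<And>k. poly_approximable w x (\<lambda>l. of_bool (l = k))"
    "summable (\<lambda>k. w k * (f k)\<^sup>2)"
  shows "poly_approximable w x f"
  unfolding poly_approximable_def
proof (intro allI impI)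
  fix \<epsilon> :: real assume "\<epsilon> > 0"
  then have \<epsilon>: "\<epsilon> / 4 > 0" by simp
  obtain K where K: "norm (\<Sum>k. w (k + K) * (f (k + K))\<^sup>2) < \<epsilon> / 4"
    using suminf_exist_split[OF \<epsilon> assms(3)] by blast
  obtain p where p: "l2_small w (\<lambda>l. (if l < K then f l else 0) - poly p (x l)) (\<epsilon> / 4)"
    using poly_approximable_finite_support[OF assms(1,2), where K = K and f = f] \<epsilon>
    unfolding poly_approximable_def by blast
  define v where "v k = (if k < K then 0 else f k)" for k
  have "(\<lambda>k. w (k + K) * (f (k + K))\<^sup>2) sums (\<Sum>k. w (k + K) * (f (k + K))\<^sup>2)"
    using assms(3) summable_iff_shift[of "\<lambda>k. w k * (f k)\<^sup>2" K] by (intro summable_sums) simp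
  then have "(\<lambda>k. w k * (v k)\<^sup>2) sums (\<Sum>k. w (k + K) * (f (k + K))\<^sup>2)"
    by (subst sums_zero_iff_shift[symmetric, of K]) (auto simp: v_def)
  then have "l2_small w v (\<epsilon> / 4)" using K by (simp add: l2_small_def sums_iff)
  from l2_small_add[OF assms(1) this p]
  have "l2_small w (\<lambda>k. v k + ((if k < K then f k else 0) - poly p (x k))) \<epsilon>" by simp
  moreover have "(\<lambda>k. v k + ((if k < K then f k else 0) - poly p (x k))) = (\<lambda>k. f k - poly p (x k))"
    by (auto simp: v_def)
  ultimately show "\<exists>p. l2_small w (\<lambda>k. f k - poly p (x k)) \<epsilon>" by metis
qed

text \<open>This translates the measure-theoretic notion into weighted sequences. Exact degrees make
  the span of the P_n all polynomials, so approximating point masses by arbitrary polynomials is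
  enough.\<close>

lemma extremal_discrete_measure:
  fixes P :: "nat \<Rightarrow> real poly"
  assumes w: "\<And>k. 0 \<le> w k"
    and deg: "\<And>n. degree (P n) \<le> n" "\<And>n. coeff (P n) n \<noteq> 0"
    and h: "\<And>n. 0 < h n"
    and orth: "\<And>n n'. (\<lambda>k. w k * poly (P n) (x k) * poly (P n') (x k)) sums (h n * (if n = n' then 1 else 0))"
    and dense: "\<And>k. poly_approximable w x (\<lambda>l. of_bool (l = k))"
  shows "extremal_measure P (discrete_measure w x)"
proof -
  let ?\<sigma> = "discrete_measure w x"
  have borel: "borel_measurable ?\<sigma> = borel_measurable borel"
    by (intro measurable_cong_sets) (simp_all add: sets_discrete_measure)
  have poly_borel: "poly p \<in> borel_measurable borel" for p :: "real poly"
    by (intro borel_measurable_continuous_onI continuous_on_poly continuous_on_id)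
  have norm: "(L2_norm ?\<sigma> f)\<^sup>2 = (\<Sum>k. w k * (f (x k))\<^sup>2)" "0 \<le> L2_norm ?\<sigma> f"
    if "f \<in> borel_measurable borel" "summable (\<lambda>k. w k * (f (x k))\<^sup>2)" for f
  proof -
    have "(\<integral>y. (f y)\<^sup>2 \<partial>?\<sigma>) = (\<Sum>k. w k * (f (x k))\<^sup>2)"
      using that w by (subst integral_discrete_measure) (simp_all add: abs_mult)
    moreover have "0 \<le> (\<Sum>k. w k * (f (x k))\<^sup>2)" using that w by (intro suminf_nonneg) auto
    ultimately show "(L2_norm ?\<sigma> f)\<^sup>2 = (\<Sum>k. w k * (f (x k))\<^sup>2)" "0 \<le> L2_norm ?\<sigma> f"
      by (simp_all add: L2_norm_def)
  qed
  have L2: "f \<in> L2 ?\<sigma> \<longleftrightarrow> f \<in> borel_measurable borel \<and> summable (\<lambda>k. w k * (f (x k))\<^sup>2)" for f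
    unfolding L2_def borel using w
    by (auto simp: integrable_discrete_measure abs_mult)
  have P_sums: "(\<lambda>k. w k * (poly (P n) (x k))\<^sup>2) sums h n" for n
    using orth[of n n] by (simp add: power2_eq_square mult_ac)
  have P_L2: "poly (P n) \<in> L2 ?\<sigma>" for n
    using P_sums[of n] poly_borel unfolding L2 by (auto simp: sums_iff)
  have P_norm: "0 < L2_norm ?\<sigma> (poly (P n))" for n
  proof -
    have "(L2_norm ?\<sigma> (poly (P n)))\<^sup>2 = h n" "0 \<le> L2_norm ?\<sigma> (poly (P n))"
      using norm[of "poly (P n)"] P_sums[of n] poly_borel by (auto simp: sums_iff)
    with h[of n] show ?thesis by (metis less_eq_real_def power_zero_numeral less_irrefl)
  qed
  have P_orth: "(\<integral>y. poly (P n) y * poly (P n') y \<partial>?\<sigma>) = 0" if "n \<noteq> n'" for n n'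
  proof -
    \<comment> \<open>Integrability requires absolute convergence, which \<open>orth\<close> does
      not assert for n and n' distinct. It follows from the two squared norms.\<close>
    have "summable (\<lambda>k. \<bar>w k * (poly (P n) (x k) * poly (P n') (x k))\<bar>)"
    proof (rule summable_comparison_test)
      show "summable (\<lambda>k. w k * (poly (P n) (x k))\<^sup>2 + w k * (poly (P n') (x k))\<^sup>2)"
        using P_sums by (intro summable_add) (auto simp: sums_iff)
      have "\<bar>u * v\<bar> \<le> u\<^sup>2 + v\<^sup>2" for u v :: real
      proof -
        have "2 * \<bar>u\<bar> * \<bar>v\<bar> \<le> u\<^sup>2 + v\<^sup>2" using sum_squares_bound[of "\<bar>u\<bar>" "\<bar>v\<bar>"] by simp
        moreover have "0 \<le> \<bar>u\<bar> * \<bar>v\<bar>" by simp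
        ultimately show ?thesis unfolding abs_mult by linarith
      qed
      then have "w k * \<bar>u * v\<bar> \<le> w k * u\<^sup>2 + w k * v\<^sup>2" for k u v
        using mult_left_mono[OF _ w] by (simp flip: distrib_left)
      then show "\<exists>N. \<forall>k\<ge>N. norm \<bar>w k * (poly (P n) (x k) * poly (P n') (x k))\<bar>
          \<le> w k * (poly (P n) (x k))\<^sup>2 + w k * (poly (P n') (x k))\<^sup>2"
        using w by (simp add: abs_mult)
    qed
    then show ?thesis
      using orth[of n n'] that w poly_borel
      by (subst integral_discrete_measure) (auto simp: sums_iff mult.assoc)
  qed
  have "\<exists>N c. L2_norm ?\<sigma> (\<lambda>y. f y - (\<Sum>n<N. c n * poly (P n) y)) < \<epsilon>"
    if f: "f \<in> L2 ?\<sigma>" and "\<epsilon> > 0" for f \<epsilon>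
  proof -
    have "summable (\<lambda>k. w k * (f (x k))\<^sup>2)" and f_borel: "f \<in> borel_measurable borel"
      using f by (simp_all add: L2)
    then have "poly_approximable w x (\<lambda>k. f (x k))"
      by (intro poly_approximable_l2[OF w dense])
    moreover have "0 < \<epsilon>\<^sup>2" using \<open>\<epsilon> > 0\<close> by simp
    ultimately obtain p where p: "l2_small w (\<lambda>k. f (x k) - poly p (x k)) (\<epsilon>\<^sup>2)"
      unfolding poly_approximable_def by blast
    obtain c where "p = (\<Sum>n\<le>degree p. smult (c n) (P n))"
      using poly_in_graded_basis[of P p "degree p"] deg by blast
    then have "poly p y = (\<Sum>n<Suc (degree p). c n * poly (P n) y)" for y
      by (metis (no_types, lifting) lessThan_Suc_atMost poly_smult poly_sum sum.cong)
    then have eq: "(\<lambda>y. f y - (\<Sum>n<Suc (degree p). c n * poly (P n) y)) = (\<lambda>y. f y - poly p y)"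
      by (auto simp del: sum.lessThan_Suc)
    have "(\<lambda>y. f y - poly p y) \<in> borel_measurable borel"
      using f_borel poly_borel[of p] by (rule borel_measurable_diff)
    then have "(L2_norm ?\<sigma> (\<lambda>y. f y - poly p y))\<^sup>2 < \<epsilon>\<^sup>2"
      using norm[of "\<lambda>y. f y - poly p y"] p by (auto simp: l2_small_def)
    then have "L2_norm ?\<sigma> (\<lambda>y. f y - poly p y) < \<epsilon>"
      by (rule power2_less_imp_less) (use \<open>\<epsilon> > 0\<close> in simp)
    then show ?thesis unfolding eq[symmetric] by blast
  qed
  then show ?thesis
    using P_L2 P_norm P_orth
    by (auto simp: extremal_measure_def orthogonality_measure_def sets_discrete_measure)
qed

section \<open>Extremality\<close>

context dual_ultraspherical
begin

text \<open>An instance of mu(x) - mu(z) = q^(-x) (1 - q^(x-z)) (1 - a q^(x+z+1)).\<close>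

lemma y_diff:
  assumes "j < l"
  shows "y l - y j
    = (1 - q ^ (2 * (l - j))) * (1 - a * q ^ (2 * l + 2 * j + 2 * e + 1)) / q ^ (2 * l + e)"
proof -
  obtain d where l: "l = j + d" using assms less_imp_add_positive by blast
  define R Q where "R = q ^ (2 * j + e)" and "Q = q ^ (2 * d)"
  have "R \<noteq> 0" "Q \<noteq> 0" using q by (simp_all add: R_def Q_def)
  have 1: "q ^ (2 * l + e) = R * Q"
    by (simp add: R_def Q_def l power_add)
  have "2 * l + 2 * j + 2 * e + 1 = 1 + (2 * j + e) * 2 + 2 * d" by (simp add: l)
  then have 2: "q ^ (2 * l + 2 * j + 2 * e + 1) = q * R\<^sup>2 * Q"
    by (simp only: R_def Q_def power_add power_one_right power_mult[of q "2 * j + e" 2])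
  have "y l - y j = (1 / (R * Q) + a * (q * (R * Q))) - (1 / R + a * (q * R))"
    unfolding mu_of_nat[OF q(1)] power_add[of q _ 1] 1 R_def[symmetric] by (simp add: mult.commute)
  also have "\<dots> = (1 - Q) * (1 - a * (q * R\<^sup>2 * Q)) / (R * Q)"
    using \<open>R \<noteq> 0\<close> \<open>Q \<noteq> 0\<close> by (simp add: field_simps power2_eq_square)
  also have "\<dots> = (1 - q ^ (2 * (l - j))) * (1 - a * q ^ (2 * l + 2 * j + 2 * e + 1)) / q ^ (2 * l + e)"
    unfolding 1 2 by (simp add: Q_def l)
  finally show ?thesis .
qed

text \<open>Both brackets of \<open>y_diff\<close> lie between 1 - q^(l-j) and 1; for the second
  this uses a q^2 < 1. The common lower bound makes products over nodes collapse to squares of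
  (q;q)_n.\<close>

lemma y_diff_bounds:
  assumes "j < l"
  shows "0 < y l - y j" and "y l - y j \<le> 1 / q ^ (2 * l + e)"
    and "(1 - q ^ (l - j))\<^sup>2 / q ^ (2 * l + e) \<le> y l - y j"
proof -
  define Q where "Q = q ^ (l - j)"
  have Q: "0 < Q" "Q < 1" unfolding Q_def using q assms by (auto intro: power_Suc_less_one simp: power_less_one_iff)
  have 1: "q ^ (2 * (l - j)) \<le> Q" "0 < q ^ (2 * (l - j))"
    unfolding Q_def using q by (auto intro!: power_decreasing)
  have "q ^ (2 * l + 2 * j + 2 * e + 1) \<le> q ^ (2 + (l - j))"
    using q assms by (intro power_decreasing) auto
  then have "a * q ^ (2 * l + 2 * j + 2 * e + 1) \<le> a * q ^ (2 + (l - j))"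
    using a(1) by (rule mult_left_mono)
  also have "\<dots> = a * q\<^sup>2 * Q" by (simp add: Q_def power_add power2_eq_square)
  also have "\<dots> \<le> 1 * Q" using a Q by (intro mult_right_mono) auto
  finally have 2: "a * q ^ (2 * l + 2 * j + 2 * e + 1) \<le> Q" "0 \<le> a * q ^ (2 * l + 2 * j + 2 * e + 1)"
    using a q by auto
  define A B where "A = 1 - q ^ (2 * (l - j))" and "B = 1 - a * q ^ (2 * l + 2 * j + 2 * e + 1)"
  have A: "1 - Q \<le> A" "0 < A" "A \<le> 1" using 1 Q by (auto simp: A_def)
  have B: "1 - Q \<le> B" "0 < B" "B \<le> 1" using 2 Q by (auto simp: B_def)
  have eq: "y l - y j = A * B / q ^ (2 * l + e)"
    unfolding y_diff[OF assms] A_def B_def ..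
  show "0 < y l - y j" unfolding eq using A B q by simp
  show "y l - y j \<le> 1 / q ^ (2 * l + e)"
    unfolding eq using A B q by (intro divide_right_mono mult_le_one) auto
  have "(1 - Q)\<^sup>2 \<le> A * B"
    unfolding power2_eq_square using A B Q by (intro mult_mono) auto
  then show "(1 - q ^ (l - j))\<^sup>2 / q ^ (2 * l + e) \<le> y l - y j"
    unfolding eq Q_def[symmetric] using q by (intro divide_right_mono) auto
qed

section \<open>Lagrange interpolation of point masses\<close>

definition lagrange :: "nat \<Rightarrow> nat \<Rightarrow> real poly" where
  "lagrange k N = (\<Prod>j\<in>{..N} - {k}. smult (1 / (y k - y j)) [: - y j, 1 :])"

lemma poly_lagrange: "poly (lagrange k N) z = (\<Prod>j\<in>{..N} - {k}. (z - y j) / (y k - y j))"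
  by (simp add: lagrange_def poly_prod diff_divide_distrib)

lemma y_inj: "j \<noteq> k \<Longrightarrow> y k - y j \<noteq> 0"
  using y_diff_bounds(1)[of j k] y_diff_bounds(1)[of k j] by (cases j k rule: linorder_cases) auto

lemma poly_lagrange_node:
  assumes "l \<le> N"
  shows "poly (lagrange k N) (y l) = of_bool (l = k)"
proof (cases "l = k")
  case True
  then show ?thesis unfolding poly_lagrange using y_inj by (auto intro!: prod.neutral)
next
  case False
  then show ?thesis unfolding poly_lagrange using assms by (auto intro!: prod_zero)
qed

text \<open>
  For a node beyond $N$ every linear factor costs at most $q^{-2l-e}$, while the denominators
  gain the product of the powers $q^{2j+e}$.
\<close>

lemma poly_lagrange_bound:
  "\<exists>B\<ge>0. \<forall>N l. k \<le> N \<longrightarrow> N < l \<longrightarrow>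
     \<bar>poly (lagrange k N) (y l)\<bar> \<le> B * q ^ (N * (N + 1) + e * (N + 1)) / q ^ ((2 * l + e) * N)"
proof -
  \<comment> \<open>The sum of the exponents 2j + e over j <= N.\<close>
  define E where "E N = N * (N + 1) + e * (N + 1)" for N
  define B where "B = (\<Prod>j<k. 1 / (y k - y j)) / q ^ E k"
  define L where "L = qpoch_inf q q"
  have L: "0 < L" "L \<le> qpoch q q n" for n
    unfolding L_def using q by (auto intro: qpoch_inf_pos qpoch_inf_le_qpoch)
  have B: "0 \<le> B"
    unfolding B_def using q y_diff_bounds(1)[of _ k] by (intro divide_nonneg_pos prod_nonneg) (auto intro: less_imp_le)
  \<comment> \<open>The induction starts at N = k: for j < k the difference y_k - y_j is governed by
    the larger index k, not by j. These finitely many factors go into B, which also divides out the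
    power q^(E k) not yet earned.\<close>
  have main: "\<bar>poly (lagrange k N) (y l)\<bar> \<le> B * q ^ E N / (qpoch q q (N - k))\<^sup>2 / q ^ ((2 * l + e) * N)"
    if "k \<le> N" "N < l" for N l
    using that
  proof (induction N rule: dec_induct)
    case base
    have "{..k} - {k} = {..<k}" by auto
    then have "\<bar>poly (lagrange k k) (y l)\<bar> = (\<Prod>j<k. \<bar>y l - y j\<bar> / \<bar>y k - y j\<bar>)"
      by (simp add: poly_lagrange abs_prod)
    also have "\<dots> \<le> (\<Prod>j<k. 1 / q ^ (2 * l + e) * (1 / (y k - y j)))"
    proof (rule prod_mono)
      fix j assume "j \<in> {..<k}"
      then have "j < k" "j < l" using base by auto
      then show "0 \<le> \<bar>y l - y j\<bar> / \<bar>y k - y j\<bar> \<and>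
          \<bar>y l - y j\<bar> / \<bar>y k - y j\<bar> \<le> 1 / q ^ (2 * l + e) * (1 / (y k - y j))"
        using y_diff_bounds(1,2)[of j l] y_diff_bounds(1)[of j k]
          divide_right_mono[of "y l - y j" "1 / q ^ (2 * l + e)" "y k - y j"] by simp
    qed
    also have "\<dots> = (\<Prod>j<k. 1 / (y k - y j)) / q ^ ((2 * l + e) * k)"
      by (simp only: prod.distrib prod_constant card_lessThan) (simp add: power_mult power_one_over)
    also have "\<dots> = B * q ^ E k / (qpoch q q (k - k))\<^sup>2 / q ^ ((2 * l + e) * k)"
      using q by (simp add: B_def)
    finally show ?case .
  next
    case (step N)
    define U where "U = 1 - q ^ (Suc N - k)"
    have U: "U > 0" using q step.hyps by (simp add: U_def power_less_one_iff)
    have set: "{..Suc N} - {k} = insert (Suc N) ({..N} - {k})" using step.hyps by auto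
    have "\<bar>poly (lagrange k (Suc N)) (y l)\<bar>
        = \<bar>poly (lagrange k N) (y l)\<bar> * ((y l - y (Suc N)) / (y (Suc N) - y k))"
    proof -
      have "\<bar>(y l - y (Suc N)) / (y k - y (Suc N))\<bar> = (y l - y (Suc N)) / (y (Suc N) - y k)"
        using y_diff_bounds(1)[of "Suc N" l] y_diff_bounds(1)[of k "Suc N"] step
        by (simp add: abs_div abs_minus_commute)
      moreover have "poly (lagrange k (Suc N)) (y l)
          = (y l - y (Suc N)) / (y k - y (Suc N)) * poly (lagrange k N) (y l)"
        unfolding poly_lagrange set by (rule prod.insert) auto
      ultimately show ?thesis by (simp only: abs_mult mult.commute)
    qed
    also have "\<dots> \<le> (B * q ^ E N / (qpoch q q (N - k))\<^sup>2 / q ^ ((2 * l + e) * N))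
        * ((1 / q ^ (2 * l + e)) / (U\<^sup>2 / q ^ (2 * Suc N + e)))"
    proof (rule mult_mono)
      show "\<bar>poly (lagrange k N) (y l)\<bar> \<le> B * q ^ E N / (qpoch q q (N - k))\<^sup>2 / q ^ ((2 * l + e) * N)"
        using step by simp
      show "(y l - y (Suc N)) / (y (Suc N) - y k) \<le> (1 / q ^ (2 * l + e)) / (U\<^sup>2 / q ^ (2 * Suc N + e))"
        using y_diff_bounds(1,2)[of "Suc N" l] y_diff_bounds(3)[of k "Suc N"] step q U
        by (intro frac_le) (auto simp: U_def)
      show "0 \<le> B * q ^ E N / (qpoch q q (N - k))\<^sup>2 / q ^ ((2 * l + e) * N)"
        using B q by simp
      show "0 \<le> (y l - y (Suc N)) / (y (Suc N) - y k)"
        using y_diff_bounds(1)[of "Suc N" l] y_diff_bounds(1)[of k "Suc N"] step by simp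
    qed
    also have "\<dots> = B * q ^ E (Suc N) / (qpoch q q (Suc N - k))\<^sup>2 / q ^ ((2 * l + e) * Suc N)"
    proof -
      have "qpoch q q (Suc N - k) = qpoch q q (N - k) * U"
        using step.hyps by (simp add: Suc_diff_le qpoch_Suc U_def)
      moreover have "E (Suc N) = E N + (2 * Suc N + e)" by (simp add: E_def algebra_simps)
      moreover have "(2 * l + e) * Suc N = (2 * l + e) * N + (2 * l + e)" by simp
      ultimately show ?thesis
        by (simp only: power_add power_mult_distrib) (simp add: field_simps)
    qed
    finally show ?case .
  qed
  show ?thesis
  proof (intro exI[of _ "B / L\<^sup>2"] conjI allI impI)
    show "0 \<le> B / L\<^sup>2" using B by simp
    fix N l assume Nl: "k \<le> N" "N < l"
    have "B * q ^ E N / (qpoch q q (N - k))\<^sup>2 \<le> B * q ^ E N / L\<^sup>2"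
      using L(1) L(2)[of "N - k"] B q by (intro divide_left_mono power_mono mult_nonneg_nonneg) (auto intro!: mult_pos_pos)
    then have "B * q ^ E N / (qpoch q q (N - k))\<^sup>2 / q ^ ((2 * l + e) * N)
        \<le> B * q ^ E N / L\<^sup>2 / q ^ ((2 * l + e) * N)"
      using q by (intro divide_right_mono) auto
    with main[OF Nl]
    show "\<bar>poly (lagrange k N) (y l)\<bar>
        \<le> B / L\<^sup>2 * q ^ (N * (N + 1) + e * (N + 1)) / q ^ ((2 * l + e) * N)"
      by (simp add: E_def)
  qed
qed

text \<open>For l = N + 1 + t the slack is 2 t (t + 1) if e = 0 and 2 (t + 1)^2 + 2N + 2 if e = 1.
  The estimate is thus sharp at the first omitted even node. The inequality is doubled in the proof
  to clear the binomial coefficient.\<close>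

lemma exponent_bound:
  assumes "N < l"
  shows "l + 2 * ((2 * l + e) * N) \<le> 2 * (N * (N + 1) + e * (N + 1)) + (2 * l + e choose 2)"
proof -
  obtain t where l: "l = N + 1 + t" using assms by (metis Suc_eq_plus1 add.commute add_Suc_right less_iff_Suc_add)
  have "2 * (2 * l + e choose 2) = (2 * l + e) * (2 * l + e - 1)" by (rule choose_two_mult_2)
  moreover have "e = 0 \<or> e = 1" using e by linarith
  ultimately have "2 * (l + 2 * ((2 * l + e) * N))
      \<le> 2 * (2 * (N * (N + 1) + e * (N + 1)) + (2 * l + e choose 2))"
    unfolding l by (auto simp: algebra_simps)
  then show ?thesis by simp
qed

text \<open>The interpolant is exact at the nodes up to N, so only l > N contributes. There each
  term is at most C q^l with C independent of N, and the geometric tail is C q^(N+1) / (1 -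
  q).\<close>

lemma poly_approximable_delta: "poly_approximable w y (\<lambda>l. of_bool (l = k))"
  unfolding poly_approximable_def
proof (intro allI impI)
  fix \<epsilon> :: real assume "\<epsilon> > 0"
  obtain B where B: "0 \<le> B" "\<And>N l. k \<le> N \<Longrightarrow> N < l \<Longrightarrow>
       \<bar>poly (lagrange k N) (y l)\<bar> \<le> B * q ^ (N * (N + 1) + e * (N + 1)) / q ^ ((2 * l + e) * N)"
    using poly_lagrange_bound[of k] by blast
  define L where "L = qpoch_inf q q"
  have L: "0 < L" unfolding L_def using q by (auto intro: qpoch_inf_pos)
  define C where "C = B\<^sup>2 / L"
  have bound: "w l * (of_bool (l = k) - poly (lagrange k N) (y l))\<^sup>2 \<le> C * q ^ l"
    if "k \<le> N" "N < l" for N l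
  proof -
    define E where "E = N * (N + 1) + e * (N + 1)"
    define X where "X = 2 * l + e"
    have "(poly (lagrange k N) (y l))\<^sup>2 \<le> (B * q ^ E / q ^ (X * N))\<^sup>2"
      using power_mono[OF B(2)[OF that], of 2] by (simp only: E_def X_def power2_abs)
    moreover have "w l \<le> q ^ (X choose 2) / L"
      using weight_bounds(2)[OF q a, of X] euler_coeff_le[OF q, of X] by (simp add: X_def L_def)
    ultimately have "w l * (poly (lagrange k N) (y l))\<^sup>2
        \<le> q ^ (X choose 2) / L * (B * q ^ E / q ^ (X * N))\<^sup>2"
      using q L by (intro mult_mono) auto
    also have "\<dots> = C * (q ^ (2 * E + (X choose 2)) / q ^ (2 * (X * N)))"
      by (simp add: C_def power_add power_mult_distrib power_divide power_mult mult_ac)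
    also have "\<dots> \<le> C * q ^ l"
    proof (rule mult_left_mono)
      have "q ^ (2 * E + (X choose 2)) \<le> q ^ (l + 2 * (X * N))"
        using exponent_bound[OF that(2)] q unfolding E_def X_def by (intro power_decreasing) auto
      then show "q ^ (2 * E + (X choose 2)) / q ^ (2 * (X * N)) \<le> q ^ l"
        using q by (simp add: power_add divide_le_eq)
      show "0 \<le> C" using L by (simp add: C_def)
    qed
    finally show ?thesis using that by simp
  qed
  have "(\<lambda>N. C * q ^ Suc N / (1 - q)) \<longlonglongrightarrow> C * 0 / (1 - q)"
    using q by (intro tendsto_intros LIMSEQ_Suc LIMSEQ_realpow_zero) auto
  then have "\<forall>\<^sub>F N in sequentially. C * q ^ Suc N / (1 - q) < \<epsilon>"
    using \<open>\<epsilon> > 0\<close> by (intro order_tendstoD) auto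
  then obtain N0 where "\<And>N. N \<ge> N0 \<Longrightarrow> C * q ^ Suc N / (1 - q) < \<epsilon>"
    by (auto simp: eventually_sequentially)
  then obtain N where N: "k \<le> N" "C * q ^ Suc N / (1 - q) < \<epsilon>"
    by (meson max.cobounded1 max.cobounded2)
  define f where "f l = w l * (of_bool (l = k) - poly (lagrange k N) (y l))\<^sup>2" for l
  define g where "g l = (if l < Suc N then 0 else C * q ^ l)" for l
  have "(\<lambda>i. C * q ^ Suc N * q ^ i) sums (C * q ^ Suc N * (1 / (1 - q)))"
    using q by (intro sums_mult geometric_sums) auto
  then have "(\<lambda>i. g (i + Suc N)) sums (C * q ^ Suc N / (1 - q))"
    by (simp add: g_def power_add mult_ac)
  then have g: "g sums (C * q ^ Suc N / (1 - q))"
    by (subst (asm) sums_zero_iff_shift) (auto simp: g_def)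
  have f0: "0 \<le> f l" for l
    using weight_bounds(1)[OF q a, of "2 * l + e"] by (simp add: f_def)
  have fg: "f l \<le> g l" for l
  proof (cases "l \<le> N")
    case True
    have "f l = 0" unfolding f_def poly_lagrange_node[OF True] by simp
    then show ?thesis using True by (simp add: g_def)
  next
    case False
    then show ?thesis using bound[OF N(1), of l] by (simp only: f_def g_def) simp
  qed
  have s: "summable f"
    using f0 fg by (intro summable_comparison_test[OF _ sums_summable[OF g]]) simp
  have "suminf f \<le> suminf g" by (rule suminf_le[OF fg s sums_summable[OF g]])
  then have "suminf f < \<epsilon>" using g N by (simp add: sums_iff)
  with s have "l2_small w (\<lambda>l. of_bool (l = k) - poly (lagrange k N) (y l)) \<epsilon>"
    unfolding l2_small_def f_def by blast
  then show "\<exists>p. l2_small w (\<lambda>l. of_bool (l = k) - poly p (y l)) \<epsilon>" ..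
qed

text \<open>Read off from the series of positive weights rather than from the infinite
  products.\<close>

lemma total_mass_pos: "0 < total_mass q a"
proof -
  have "0 < (\<Sum>k. w k)"
    using weight_bounds(1)[OF q a] by (intro suminf_pos summable_weight[OF q a e])
  with weight_sums[OF q a e] show ?thesis by (simp add: sums_iff)
qed

lemma extremal: "extremal_measure (D a q) (discrete_measure w y)"
proof (rule extremal_discrete_measure[OF _ degree_D coeff_D_nonzero _ D_orthogonality poly_approximable_delta])
  show "0 < total_mass q a * (qpoch (q\<^sup>2) (q\<^sup>2) n * q powi (- int n) / qpoch (a * q\<^sup>2) (q\<^sup>2) n)" for n
    using total_mass_pos qpoch_aq2_pos q a
    by (intro mult_pos_pos divide_pos_pos qpoch_pos) (auto simp: power_less_one_iff power_int_minus)
  show "0 \<le> w k" for k using weight_bounds(1)[OF q a] by (rule less_imp_le)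
qed

end

theorem mainTheorem2:
  fixes a q :: real
  assumes "0 < q" and "q < 1" and "0 < a" and "a < q powi (-2)"
  shows
    "(\<forall>n n'. (\<lambda>k. w_even a q k * poly (D a q n) (mu a q (real (2 * k)))
                              * poly (D a q n') (mu a q (real (2 * k))))
        sums (qpoch_inf (a * q ^ 3) (q\<^sup>2) / qpoch_inf q (q\<^sup>2)
              * (qpoch (q\<^sup>2) (q\<^sup>2) n * q powi (- int n) / qpoch (a * q\<^sup>2) (q\<^sup>2) n)
              * (if n = n' then 1 else 0))) \<and>
     (\<forall>n n'. (\<lambda>k. w_odd a q k * poly (D a q n) (mu a q (real (2 * k + 1)))
                             * poly (D a q n') (mu a q (real (2 * k + 1))))
        sums (qpoch_inf (a * q ^ 3) (q\<^sup>2) / qpoch_inf q (q\<^sup>2)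
              * (qpoch (q\<^sup>2) (q\<^sup>2) n * q powi (- int n) / qpoch (a * q\<^sup>2) (q\<^sup>2) n)
              * (if n = n' then 1 else 0))) \<and>
     (\<forall>k. w_even a q k > 0) \<and> (\<forall>k. w_odd a q k > 0) \<and>
     extremal_measure (D a q) (discrete_measure (w_even a q) (\<lambda>k. mu a q (real (2 * k)))) \<and>
     extremal_measure (D a q) (discrete_measure (w_odd a q) (\<lambda>k. mu a q (real (2 * k + 1))))"
proof -
  have aq: "0 \<le> a" "a * q\<^sup>2 < 1"
    using assms by (simp_all add: power_int_minus field_simps)
  interpret even: dual_ultraspherical q a 0
    using assms aq by unfold_locales auto
  interpret odd: dual_ultraspherical q a 1
    using assms aq by unfold_locales auto
  have w: "w_even a q = (\<lambda>k. weight a q (2 * k))" "w_odd a q = (\<lambda>k. weight a q (2 * k + 1))"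
    by (simp_all add: fun_eq_iff w_even_eq_weight w_odd_eq_weight)
  show ?thesis
    unfolding w total_mass_def[symmetric]
    using even.D_orthogonality odd.D_orthogonality even.extremal odd.extremal
      weight_bounds(1)[OF assms(1,2) aq]
    by (simp only: add_0_right) blast
qed

end
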